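(* Let $f,g,A,B,b,\beta$ satisfy the standing assumptions in the context, with $L>0$ and $\sigma\in[-L,L]$ the smoothness and hypoconvexity moduli of $(Af)$, and let $p_1=\sigma/L$, $\gamma=1/\beta$. Let $\lambda>0$ and suppose one of the following holds: (A) $\lambda\in(0,2)$ and $\gamma<\min\{\frac{2-\lambda}{2[\sigma]_-},\frac1L\}$, in which case set $$c=\frac{2-\lambda}{2\lambda\gamma}-\begin{cases}L\max\left\{\frac{[p_1]_-}{2(1-[p_1]_-)},\ \frac{\gamma L}{\lambda}-\frac12\right\}&\text{if }p_1\ge\frac\lambda2-1,\\[1mm]\frac{[\sigma]_-}{\lambda}&\text{otherwise;}\end{cases}$$ (B) $\sigma>0$, $2\le\lambda<\frac{4}{1+\sqrt{1-p_1}}$ and $\frac{p_1\lambda-\delta}{4\sigma}<\gamma<\frac{p_1\lambda+\delta}{4\sigma}$ with $\delta=\sqrt{(p_1\lambda)^2-8p_1(\lambda-2)}$, in which case set $c=\frac{2-\lambda}{2\lambda\gamma}+\sigma\left(\frac12-\frac{\gamma L}{\lambda}\right)$. Starting from $(x^{-1},y^{-1},z^{-1})\in\mathbb R^m\times\mathbb R^p\times\mathbb R^n$, let $(x^k,y^k,z^k)_{k\ge0}$ be generated by ADMM with penalty $\beta$ and relaxation $\lambda$. Then: (i) For all $k\ge0$, $\mathcal L_\beta(x^{k+1},z^{k+1},y^{k+1})\le\mathcal L_\beta(x^k,z^k,y^k)-\frac{c\lambda^2}{(1+\gamma L)^2}\|Ax^k+Bz^k-b\|^2$, and the residual $(Ax^k+Bz^k-b)_k$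 vanishes with $\min_{i\le k}\|Ax^i+Bz^i-b\|=o(1/\sqrt k)$. (ii) All cluster points $(x,z,y)$ of $(x^k,z^k,y^k)_k$ satisfy the KKT conditions $-A^\top y\in\partial f(x)$, $-B^\top y\in\partial g(z)$, $Ax+Bz=b$, and attain the same cost $f(x)+g(z)$, this being the limit of $(\mathcal L_\beta(x^k,z^k,y^k))_k$. (iii) The sequence $(Ax^k,y^k,Bz^k)_k$ is bounded provided that $\Phi$ is level bounded. If, additionally, $f$ is differentiable with Lipschitz continuous gradient on $\mathbb R^m$, then the sequence $(x^k,y^k,z^k)_k$ is bounded.
   Context: Problem: minimize $f(x)+g(z)$ subject to $Ax+Bz=b$, with $A\in\mathbb R^{p\times m}$, $B\in\mathbb R^{p\times n}$, $b\in\mathbb R^p$. Image function: $(Ch)(s)=\inf\{h(x):Cx=s\}$. Standing assumptions: $f:\mathbb R^m\to\mathbb R$ and $g:\mathbb R^n\to\mathbb R\cup\{\infty\}$ are proper and lower semicontinuous (lsc); $A$ is surjective; $\beta>0$ is large enough that the ADMM subproblems have solutions, i.e. $\operatorname{argmin}\{f+\frac\beta2\|A\cdot-s\|^2\}$ and $\operatorname{argmin}\{g+\frac\beta2\|B\cdot-s\|^2\}$ are nonempty for all $s\in\mathbb R^p$; $(Af):\mathbb R^p\to\mathbb R$ is $L$-smooth (differentiable with $L$-Lipschitz gradient) and $\sigma$-hypoconvex ($(Af)-\frac\sigma2\|\cdot\|^2$ is convex); $(Bg)$ is lsc; and $\operatorname{argmin}\Phi\ne\emptyset$, where $\Phi(x,z)=f(x)+g(z)$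 if $Ax+Bz=b$ and $\Phi(x,z)=\infty$ otherwise. Augmented Lagrangian: $\mathcal L_\beta(x,z,y)=f(x)+g(z)+\langle y,Ax+Bz-b\rangle+\frac\beta2\|Ax+Bz-b\|^2$. ADMM: from $(x,y,z)$, one update gives $y^{+/2}=y-\beta(1-\lambda)(Ax+Bz-b)$; $x^+\in\operatorname{argmin}\mathcal L_\beta(\cdot,z,y^{+/2})$; $y^+=y^{+/2}+\beta(Ax^++Bz-b)$; $z^+\in\operatorname{argmin}\mathcal L_\beta(x^+,\cdot,y^+)$. Notation: $[r]_-=\max\{0,-r\}$, with $r/0=\infty$ for $r>0$. A function is level bounded if all its sublevel sets $\{h\le\alpha\}$, $\alpha\in\mathbb R$, are bounded. Regular subdifferential: $v\in\hat\partial h(\bar x)$ iff $\liminf_{x\to\bar x,\,x\ne\bar x}\frac{h(x)-h(\bar x)-\langle v,x-\bar x\rangle}{\|x-\bar x\|}\ge0$. Limiting subdifferential: $v\in\partial h(\bar x)$ iff there exist $x^k\to\bar x$ with $h(x^k)\to h(\bar x)$ and $v^k\in\hat\partial h(x^k)$ with $v^k\to v$. *)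

theory Defs
  imports "HOL-Analysis.Analysis" "HOL-Library.Landau_Symbols"
begin

definition neg_part :: "real \<Rightarrow> real" where
  "neg_part r = max 0 (- r)"

definition argmin_set :: "('a \<Rightarrow> 'b::order) \<Rightarrow> 'a set" where
  "argmin_set h = {x. is_arg_min h (\<lambda>_. True) x}"

definition proper :: "('a \<Rightarrow> ereal) \<Rightarrow> bool" where
  "proper h \<longleftrightarrow> (\<forall>x. h x \<noteq> -\<infinity>) \<and> (\<exists>x. h x \<noteq> \<infinity>)"

definition lsc :: "('a::t2_space \<Rightarrow> ereal) \<Rightarrow> bool" where
  "lsc h \<longleftrightarrow> (\<forall>x. h x \<le> Liminf (at x) h)"

definition level_bounded :: "('a::metric_space \<Rightarrow> ereal) \<Rightarrow> bool" where
  "level_bounded h \<longleftrightarrow> (\<forall>\<alpha>::real. bounded {x. h x \<le> ereal \<alpha>})"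

definition smooth_with :: "real \<Rightarrow> ('a::real_inner \<Rightarrow> real) \<Rightarrow> bool" where
  "smooth_with L h \<longleftrightarrow> (\<exists>grad. (\<forall>x. GDERIV h x :> grad x) \<and> lipschitz_on L UNIV grad)"

definition hypoconvex :: "real \<Rightarrow> ('a::real_inner \<Rightarrow> real) \<Rightarrow> bool" where
  "hypoconvex \<sigma> h \<longleftrightarrow> convex_on UNIV (\<lambda>x. h x - \<sigma> / 2 * (norm x)\<^sup>2)"

text \<open>The infimum over the empty set is \<open>\<infinity>\<close>.\<close>

definition image_fun :: "real^'m^'p \<Rightarrow> (real^'m \<Rightarrow> ereal) \<Rightarrow> real^'p \<Rightarrow> ereal" where
  "image_fun C h s = (INF x\<in>{x. C *v x = s}. h x)"

text \<open>Both subdifferentials are empty at points where the function is not finite; without this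
  guard the arithmetic of \<open>ereal\<close> (\<open>\<infinity> - \<infinity> = \<infinity>\<close>) would produce spurious subgradients there.\<close>

definition regular_subdiff :: "('a::real_inner \<Rightarrow> ereal) \<Rightarrow> 'a \<Rightarrow> 'a set" where
  "regular_subdiff h xb = {v. \<bar>h xb\<bar> \<noteq> \<infinity> \<and>
     0 \<le> Liminf (at xb) (\<lambda>x. (h x - h xb - ereal (inner v (x - xb))) / ereal (norm (x - xb)))}"

definition limiting_subdiff :: "('a::real_inner \<Rightarrow> ereal) \<Rightarrow> 'a \<Rightarrow> 'a set" where
  "limiting_subdiff h xb = {v. \<bar>h xb\<bar> \<noteq> \<infinity> \<and>
     (\<exists>xs vs. xs \<longlonglongrightarrow> xb \<and> (\<lambda>k. h (xs k)) \<longlonglongrightarrow> h xb \<and>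
        (\<forall>k. vs k \<in> regular_subdiff h (xs k)) \<and> vs \<longlonglongrightarrow> v)}"

definition cluster_point :: "(nat \<Rightarrow> 'a::topological_space) \<Rightarrow> 'a \<Rightarrow> bool" where
  "cluster_point u l \<longleftrightarrow> (\<exists>r::nat \<Rightarrow> nat. strict_mono r \<and> (u \<circ> r) \<longlonglongrightarrow> l)"

text \<open>The problem is to minimize \<open>f x + g z\<close> subject to \<open>A x + B z = b\<close>.\<close>

definition residual :: "real^'m^'p \<Rightarrow> real^'n^'p \<Rightarrow> real^'p \<Rightarrow> real^'m \<Rightarrow> real^'n \<Rightarrow> real^'p" where
  "residual A B b x z = A *v x + B *v z - b"

definition Phi :: "(real^'m \<Rightarrow> real) \<Rightarrow> (real^'n \<Rightarrow> ereal) \<Rightarrow> real^'m^'p \<Rightarrow> real^'n^'p \<Rightarrow> real^'p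
    \<Rightarrow> (real^'m) \<times> (real^'n) \<Rightarrow> ereal" where
  "Phi f g A B b = (\<lambda>(x, z). if A *v x + B *v z = b then ereal (f x) + g z else \<infinity>)"

definition aug_lagrangian :: "(real^'m \<Rightarrow> real) \<Rightarrow> (real^'n \<Rightarrow> ereal) \<Rightarrow> real^'m^'p \<Rightarrow> real^'n^'p
    \<Rightarrow> real^'p \<Rightarrow> real \<Rightarrow> real^'m \<Rightarrow> real^'n \<Rightarrow> real^'p \<Rightarrow> ereal" where
  "aug_lagrangian f g A B b \<beta> x z y =
     ereal (f x) + g z
       + ereal (inner y (residual A B b x z) + \<beta> / 2 * (norm (residual A B b x z))\<^sup>2)"

text \<open>In the minimization over \<open>x\<close> the summand \<open>g z\<close> is constant, and is replaced by \<open>0\<close>: the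
  starting point may lie outside the domain of \<open>g\<close>, where the Lagrangian is identically \<open>\<infinity>\<close> in
  \<open>x\<close>, and where every \<open>x\<close> would otherwise count as a minimizer.  On the domain of \<open>g\<close> nothing
  changes, by the lemma that follows.\<close>

definition admm_step :: "(real^'m \<Rightarrow> real) \<Rightarrow> (real^'n \<Rightarrow> ereal) \<Rightarrow> real^'m^'p \<Rightarrow> real^'n^'p
    \<Rightarrow> real^'p \<Rightarrow> real \<Rightarrow> real \<Rightarrow> (real^'m) \<times> (real^'p) \<times> (real^'n)
    \<Rightarrow> (real^'m) \<times> (real^'p) \<times> (real^'n) \<Rightarrow> bool" where
  "admm_step f g A B b \<beta> lam = (\<lambda>(x, y, z) (x', y', z').
     let yh = y - (\<beta> * (1 - lam)) *\<^sub>R residual A B b x z in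
       x' \<in> argmin_set (\<lambda>u. aug_lagrangian f (\<lambda>_. 0) A B b \<beta> u z yh) \<and>
       y' = yh + \<beta> *\<^sub>R residual A B b x' z \<and>
       z' \<in> argmin_set (\<lambda>w. aug_lagrangian f g A B b \<beta> x' w y'))"

lemma argmin_set_aug_lagrangian_x:
  assumes "\<bar>g z\<bar> \<noteq> \<infinity>"
  shows "argmin_set (\<lambda>u. aug_lagrangian f g A B b \<beta> u z y)
       = argmin_set (\<lambda>u. aug_lagrangian f (\<lambda>_. 0) A B b \<beta> u z y)"
  using assms
  by (cases "g z") (auto simp: argmin_set_def is_arg_min_def aug_lagrangian_def)

definition kkt_point :: "(real^'m \<Rightarrow> real) \<Rightarrow> (real^'n \<Rightarrow> ereal) \<Rightarrow> real^'m^'p \<Rightarrow> real^'n^'p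
    \<Rightarrow> real^'p \<Rightarrow> real^'m \<Rightarrow> real^'n \<Rightarrow> real^'p \<Rightarrow> bool" where
  "kkt_point f g A B b x z y \<longleftrightarrow>
     - (transpose A *v y) \<in> limiting_subdiff (\<lambda>u. ereal (f u)) x \<and>
     - (transpose B *v y) \<in> limiting_subdiff g z \<and>
     A *v x + B *v z = b"

end

theory Submission
  imports Defs
begin

text \<open>Everything happens in the space of the constraint.  Let \<open>F = (Af)\<close> with gradient \<open>G\<close>, \<open>u = A x\<close>, \<open>v = b - B z\<close>.
The \<open>x\<close>-update makes \<open>f x = F u\<close> and \<open>y = - G u\<close>, so the augmented Lagrangian at an iterate is
the Douglas-Rachford envelope
\<open>F u + \<langle>G u, v - u\<rangle> + \<beta> / 2 * \<bar>v - u\<bar>\<^sup>2 + g z\<close>, in which the multiplier has disappeared.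
The \<open>z\<close>-update minimizes this expression over \<open>z\<close>; using the old \<open>z\<close> as a competitor bounds the
change of the envelope in one iteration.  With \<open>d\<close> and \<open>e\<close> the increments of \<open>u\<close> and of \<open>G u\<close>,
the multiplier update reads \<open>\<lambda> (v - u) = d + \<gamma> e\<close>, and the bound becomes
\<open>\<gamma> / \<lambda> * \<bar>e\<bar>\<^sup>2 - D - (2 - \<lambda>) / (2 \<lambda> \<gamma>) * \<bar>d\<bar>\<^sup>2\<close>, where \<open>D\<close> is the gap at the old point \<open>u\<close>
between \<open>F\<close> and its tangent at the new point.

The constants of the theorem come from bounding \<open>D\<close> from below by a combination of \<open>\<bar>d\<bar>\<^sup>2\<close> and
\<open>\<bar>e\<bar>\<^sup>2\<close>, which comes from the interpolation inequality of convex smooth functions applied to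
\<open>F - \<sigma> / 2 * \<bar>\<cdot>\<bar>\<^sup>2\<close> (lemmas \<open>bregman_lower_bound_nonneg\<close> and \<open>bregman_lower_bound_nonpos\<close>); lemma
\<open>relaxation_gain\<close> shows that the two parameter regimes make the bound at most \<open>- c * \<bar>d\<bar>\<^sup>2\<close> with
\<open>c > 0\<close>, and also that \<open>\<gamma> L < 1\<close>.  Since \<open>\<lambda> \<bar>v - u\<bar> \<le> (1 + \<gamma> L) \<bar>d\<bar>\<close>, this is the claimed decrease.

Because \<open>L < \<beta>\<close>, the descent inequality for \<open>F\<close> puts the envelope above \<open>F v + g z\<close>, hence above
\<open>min \<Phi>\<close>: the Lagrangian converges, and the squared residuals are summable.  At a cluster point the
optimality conditions of the two subproblems pass to the limit; the required convergence of function
values follows from continuity of \<open>F\<close> for \<open>f\<close>, and from comparing \<open>z\<^sup>k\<close> with its limit for \<open>g\<close>.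
Finally, \<open>F v + g z\<close> bounded above means that \<open>z\<close>, together with a nearly optimal \<open>x\<close> in the
fibre over \<open>v\<close>, stays in a level set of \<open>\<Phi>\<close>; when \<open>f\<close> is smooth, moving \<open>x\<^sup>k\<close> into this fibre
changes \<open>f\<close> by a bounded amount only, so that \<open>x\<^sup>k\<close> itself is bounded.\<close>

section \<open>Smooth hypoconvex functions\<close>

lemma GDERIV_along_line:
  assumes "GDERIV h (x + t *\<^sub>R d) :> D"
  shows "((\<lambda>t. h (x + t *\<^sub>R d)) has_real_derivative inner D d) (at t)"
proof -
  have "((\<lambda>t. h (x + t *\<^sub>R d)) has_derivative (\<lambda>s. inner (s *\<^sub>R d) D)) (at t)"
    using assms unfolding gderiv_def
    by (rule has_derivative_compose[rotated]) (auto intro!: derivative_eq_intros)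
  then show ?thesis
    by (simp add: has_field_derivative_def inner_commute mult_commute_abs)
qed

text \<open>Along the segment, the difference of the two sides is nonincreasing, since its derivative is
controlled by the Lipschitz bound on the gradient.\<close>

lemma quadratic_upper_bound_of_lipschitz_gradient:
  assumes "\<And>x. GDERIV h x :> G x" and "lipschitz_on L UNIV G"
  shows "h y \<le> h x + inner (G x) (y - x) + L / 2 * (norm (y - x))\<^sup>2"
proof -
  define d where "d = y - x"
  define \<psi> where "\<psi> t = h (x + t *\<^sub>R d) - t * inner (G x) d - L / 2 * t\<^sup>2 * (norm d)\<^sup>2" for t
  have "\<exists>m. (\<psi> has_real_derivative m) (at t) \<and> m \<le> 0" if "0 \<le> t" for t
  proof (intro exI conjI)
    show "(\<psi> has_real_derivative (inner (G (x + t *\<^sub>R d)) d - inner (G x) d - L * t * (norm d)\<^sup>2)) (at t)"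
      unfolding \<psi>_def
      by (rule derivative_eq_intros GDERIV_along_line assms(1) refl | simp)+
    have "inner (G (x + t *\<^sub>R d) - G x) d \<le> norm (G (x + t *\<^sub>R d) - G x) * norm d"
      by (rule norm_cauchy_schwarz)
    also have "\<dots> \<le> (L * norm (t *\<^sub>R d)) * norm d"
      using lipschitz_onD[OF assms(2), of "x + t *\<^sub>R d" x]
      by (intro mult_right_mono) (auto simp: dist_norm)
    finally show "inner (G (x + t *\<^sub>R d)) d - inner (G x) d - L * t * (norm d)\<^sup>2 \<le> 0"
      using that by (simp add: inner_diff_left power2_eq_square)
  qed
  then have "\<psi> 1 \<le> \<psi> 0"
    using DERIV_nonpos_imp_nonincreasing[of 0 1 \<psi>] by (metis zero_le_one)
  then show ?thesis by (simp add: \<psi>_def d_def)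
qed

lemma convex_above_tangent:
  assumes "convex_on UNIV h" and "\<And>x. GDERIV h x :> G x"
  shows "h x + inner (G x) (y - x) \<le> h y"
proof -
  have "convex_on UNIV (\<lambda>t::real. h (x + t *\<^sub>R (y - x)))"
  proof (rule convex_onI)
    fix t s r :: real assume t: "0 < t" "t < 1"
    have "x + ((1 - t) *\<^sub>R s + t *\<^sub>R r) *\<^sub>R (y - x)
        = (1 - t) *\<^sub>R (x + s *\<^sub>R (y - x)) + t *\<^sub>R (x + r *\<^sub>R (y - x))"
      by (simp add: algebra_simps)
    then show "h (x + ((1 - t) *\<^sub>R s + t *\<^sub>R r) *\<^sub>R (y - x))
        \<le> (1 - t) * h (x + s *\<^sub>R (y - x)) + t * h (x + r *\<^sub>R (y - x))"
      using convex_onD[OF assms(1), of t] t by simp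
  qed auto
  moreover have "((\<lambda>t. h (x + t *\<^sub>R (y - x))) has_real_derivative inner (G x) (y - x)) (at 0)"
    using GDERIV_along_line[where x = x and t = 0 and d = "y - x", OF assms(2)] by simp
  ultimately have "h (x + 1 *\<^sub>R (y - x)) - h (x + 0 *\<^sub>R (y - x)) \<ge> inner (G x) (y - x) * (1 - 0)"
    by (intro convex_on_imp_above_tangent[where A = UNIV]) auto
  then show ?thesis by simp
qed

text \<open>A tangent at \<open>x\<close> lies below \<open>h\<close>, which lies below a quadratic touching it at \<open>y\<close>; evaluating
both at the minimizer of their difference leaves a gap of the size of the squared difference of the
gradients.  The inequality is multiplied out so that it covers affine functions, \<open>M = 0\<close>.\<close>

lemma convex_smooth_interpolation:
  fixes h :: "'a::real_inner \<Rightarrow> real"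
  assumes cvx: "convex_on UNIV h" and grad: "\<And>x. GDERIV h x :> w x"
    and M: "0 \<le> M"
    and upper: "\<And>x y. h y \<le> h x + inner (w x) (y - x) + M / 2 * (norm (y - x))\<^sup>2"
  shows "(norm (w y - w x))\<^sup>2 \<le> 2 * M * (h y - h x - inner (w x) (y - x))"
proof -
  define D where "D = h y - h x - inner (w x) (y - x)"
  define e where "e = w y - w x"
  have pos: "(norm e)\<^sup>2 \<le> 2 * N * D" if "N > 0" "M \<le> N" for N
  proof -
    \<comment> \<open>the minimizer of the quadratic upper bound at \<open>y\<close> minus the tangent at \<open>x\<close>\<close>
    define \<xi> where "\<xi> = y - (1 / N) *\<^sub>R e"
    have "h x + inner (w x) (\<xi> - x) \<le> h \<xi>" by (rule convex_above_tangent[OF cvx grad])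
    also have "\<dots> \<le> h y + inner (w y) (\<xi> - y) + M / 2 * (norm (\<xi> - y))\<^sup>2" by (rule upper)
    also have "\<dots> \<le> h y + inner (w y) (\<xi> - y) + N / 2 * (norm (\<xi> - y))\<^sup>2"
      using that by (simp add: mult_right_mono)
    finally have "inner e (y - \<xi>) - N / 2 * (norm (\<xi> - y))\<^sup>2 \<le> D"
      by (simp add: D_def e_def inner_diff_left inner_diff_right)
    moreover have "inner e (y - \<xi>) - N / 2 * (norm (\<xi> - y))\<^sup>2 = (norm e)\<^sup>2 / (2 * N)"
      using \<open>N > 0\<close> by (simp add: \<xi>_def power2_norm_eq_inner[symmetric] power_divide field_simps power2_eq_square)
    ultimately have "(norm e)\<^sup>2 / (2 * N) \<le> D" by simp
    then show ?thesis using \<open>N > 0\<close> by (simp add: field_simps)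
  qed
  \<comment> \<open>for \<open>M = 0\<close> the step \<open>1 / M\<close> is replaced by an arbitrarily long one\<close>
  show ?thesis
  proof (cases "M = 0")
    case True
    have "D \<ge> 0" using convex_above_tangent[OF cvx grad, of x y] by (simp add: D_def)
    have "(norm e)\<^sup>2 \<le> 0"
    proof (rule field_le_epsilon)
      fix \<epsilon> :: real assume "\<epsilon> > 0"
      have "(norm e)\<^sup>2 \<le> 2 * (\<epsilon> / (2 * (D + 1))) * D"
        using \<open>\<epsilon> > 0\<close> \<open>D \<ge> 0\<close> True by (intro pos) auto
      also have "\<dots> \<le> \<epsilon>" using \<open>\<epsilon> > 0\<close> \<open>D \<ge> 0\<close> by (simp add: field_simps)
      finally show "(norm e)\<^sup>2 \<le> 0 + \<epsilon>" by simp
    qed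
    then show ?thesis using True by (simp add: e_def)
  next
    case False
    then show ?thesis using pos[of M] M by (simp add: D_def e_def)
  qed
qed

lemma norm_add_scaleR_sq:
  "(norm (a + c *\<^sub>R d))\<^sup>2 = (norm a)\<^sup>2 + 2 * c * inner a d + c\<^sup>2 * (norm (d::'a::real_inner))\<^sup>2"
  unfolding power2_norm_eq_inner
  by (simp add: inner_add_left inner_add_right inner_commute power2_eq_square algebra_simps)

lemma GDERIV_half_norm_sq: "GDERIV (\<lambda>x::'a::real_inner. \<sigma> / 2 * (norm x)\<^sup>2) x :> \<sigma> *\<^sub>R x"
  unfolding gderiv_def power2_norm_eq_inner
  by (auto intro!: derivative_eq_intros simp: inner_commute algebra_simps)

text \<open>Interpolation for the convex part \<open>h = F - \<sigma> / 2 * \<bar>\<cdot>\<bar>\<^sup>2\<close>, which has gradient \<open>w\<close> and a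
quadratic upper bound with constant \<open>L - \<sigma>\<close>.
Here \<open>Dh\<close> is the gap between \<open>h\<close> and its tangent, \<open>ww\<close> the squared norm of the
increment \<open>W\<close> of \<open>w\<close>, and \<open>wd\<close> the inner product of \<open>W\<close> with \<open>y - x\<close>.  Only these numbers enter the
comparison of \<open>F\<close> with its tangents, which is thereby reduced to real arithmetic.\<close>

lemma hypoconvex_smooth_bregman:
  fixes F :: "'a::real_inner \<Rightarrow> real"
  assumes grad: "\<And>x. GDERIV F x :> G x" and lip: "lipschitz_on L UNIV G"
    and hypo: "hypoconvex \<sigma> F" and le: "\<sigma> \<le> L"
  obtains Dh ww wd where
    "F y - F x - inner (G x) (y - x) = \<sigma> / 2 * (norm (y - x))\<^sup>2 + Dh"
    "(norm (G y - G x))\<^sup>2 = ww + 2 * \<sigma> * wd + \<sigma>\<^sup>2 * (norm (y - x))\<^sup>2"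
    "0 \<le> ww" "0 \<le> Dh" "ww \<le> 2 * (L - \<sigma>) * Dh" "ww \<le> (L - \<sigma>) * wd"
    "2 * (L - \<sigma>) * wd \<le> ww + (L - \<sigma>)\<^sup>2 * (norm (y - x))\<^sup>2"
    "L = \<sigma> \<Longrightarrow> wd = 0"
proof -
  define h where "h x = F x - \<sigma> / 2 * (norm x)\<^sup>2" for x
  define w where "w x = G x - \<sigma> *\<^sub>R x" for x
  have cvx: "convex_on UNIV h" using hypo unfolding hypoconvex_def h_def .
  have gh: "GDERIV h x :> w x" for x
    unfolding h_def w_def by (rule GDERIV_diff[OF grad GDERIV_half_norm_sq])
  have eq: "F y - F x - inner (G x) (y - x)
      = h y - h x - inner (w x) (y - x) + \<sigma> / 2 * (norm (y - x))\<^sup>2" for x y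
    by (simp add: h_def w_def power2_norm_eq_inner inner_diff_left inner_diff_right
        inner_commute algebra_simps)
  have up: "h y \<le> h x + inner (w x) (y - x) + (L - \<sigma>) / 2 * (norm (y - x))\<^sup>2" for x y
    using quadratic_upper_bound_of_lipschitz_gradient[OF grad lip, of y x] eq[of y x]
    by (simp add: algebra_simps diff_divide_distrib)
  have M: "0 \<le> L - \<sigma>" using le by simp
  note int = convex_smooth_interpolation[OF cvx gh M up]
  define W where "W = w y - w x"
  have sym: "(norm W)\<^sup>2 \<le> (L - \<sigma>) * inner W (y - x)"
  proof -
    have "2 * (norm W)\<^sup>2 \<le> 2 * (L - \<sigma>) * (h y - h x - inner (w x) (y - x))
        + 2 * (L - \<sigma>) * (h x - h y - inner (w y) (x - y))"
      using int[of y x] int[of x y] by (simp add: W_def norm_minus_commute)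
    also have "\<dots> = 2 * ((L - \<sigma>) * inner W (y - x))"
      by (simp add: W_def inner_diff_left inner_diff_right algebra_simps)
    finally show ?thesis by simp
  qed
  show thesis
  proof (rule that[of "h y - h x - inner (w x) (y - x)" "(norm W)\<^sup>2" "inner W (y - x)"])
    show "(norm (G y - G x))\<^sup>2
        = (norm W)\<^sup>2 + 2 * \<sigma> * inner W (y - x) + \<sigma>\<^sup>2 * (norm (y - x))\<^sup>2"
    proof -
      have "G y - G x = W + \<sigma> *\<^sub>R (y - x)" by (simp add: W_def w_def algebra_simps)
      then show ?thesis by (simp add: norm_add_scaleR_sq)
    qed
    show "2 * (L - \<sigma>) * inner W (y - x) \<le> (norm W)\<^sup>2 + (L - \<sigma>)\<^sup>2 * (norm (y - x))\<^sup>2"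
    proof -
      have "0 \<le> (norm (W + (- (L - \<sigma>)) *\<^sub>R (y - x)))\<^sup>2" by simp
      then show ?thesis unfolding norm_add_scaleR_sq power2_minus by (simp add: algebra_simps)
    qed
    show "inner W (y - x) = 0" if "L = \<sigma>" using sym that by simp
    show "F y - F x - inner (G x) (y - x)
        = \<sigma> / 2 * (norm (y - x))\<^sup>2 + (h y - h x - inner (w x) (y - x))"
      using eq[of y x] by linarith
    show "0 \<le> h y - h x - inner (w x) (y - x)"
      using convex_above_tangent[OF cvx gh, of x y] by linarith
    show "(norm W)\<^sup>2 \<le> 2 * (L - \<sigma>) * (h y - h x - inner (w x) (y - x))"
      unfolding W_def by (rule int)
    show "(norm W)\<^sup>2 \<le> (L - \<sigma>) * inner W (y - x)" by (rule sym)
  qed simp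
qed

text \<open>The estimate is affine in \<open>\<theta>\<close>.  At \<open>\<theta> = 0\<close> it is strong convexity, at \<open>\<theta> = 1 / (2 * L)\<close> it is
cocoercivity of the gradient in the form \<open>\<bar>G y - G x\<bar>\<^sup>2 / (2 * L)\<close>; for relaxations
\<open>lam \<ge> 2\<close> it is used with \<open>\<theta> = \<gamma> / lam\<close>.\<close>

lemma bregman_lower_bound_nonneg:
  fixes F :: "'a::real_inner \<Rightarrow> real"
  assumes grad: "\<And>x. GDERIV F x :> G x" and lip: "lipschitz_on L UNIV G"
    and hypo: "hypoconvex \<sigma> F" and s: "0 \<le> \<sigma>" "\<sigma> \<le> L" and \<theta>: "0 \<le> \<theta>" "2 * \<theta> * L \<le> 1"
  shows "\<sigma> / 2 * (norm (y - x))\<^sup>2 + \<theta> * ((norm (G y - G x))\<^sup>2 - \<sigma> * L * (norm (y - x))\<^sup>2)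
    \<le> F y - F x - inner (G x) (y - x)"
proof -
  define dd where "dd = (norm (y - x))\<^sup>2"
  obtain Dh ww wd where *:
    "F y - F x - inner (G x) (y - x) = \<sigma> / 2 * dd + Dh"
    "(norm (G y - G x))\<^sup>2 = ww + 2 * \<sigma> * wd + \<sigma>\<^sup>2 * dd"
    "0 \<le> ww" "0 \<le> Dh" "ww \<le> 2 * (L - \<sigma>) * Dh" "ww \<le> (L - \<sigma>) * wd"
    "2 * (L - \<sigma>) * wd \<le> ww + (L - \<sigma>)\<^sup>2 * dd" "L = \<sigma> \<Longrightarrow> wd = 0"
    unfolding dd_def by (rule hypoconvex_smooth_bregman[OF grad lip hypo s(2), of y x]) iprover
  have "\<theta> * (ww + 2 * \<sigma> * wd - \<sigma> * (L - \<sigma>) * dd) \<le> Dh"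
  proof (cases "L = \<sigma>")
    case True
    then show ?thesis using * by simp
  next
    case False
    then have M: "0 < L - \<sigma>" using s by simp
    have "(L - \<sigma>) * (ww + 2 * \<sigma> * wd - \<sigma> * (L - \<sigma>) * dd)
        = (L - \<sigma>) * ww + \<sigma> * (2 * (L - \<sigma>) * wd - (L - \<sigma>)\<^sup>2 * dd)"
      by (simp add: algebra_simps power2_eq_square)
    also have "\<dots> \<le> (L - \<sigma>) * ww + \<sigma> * ww"
      using *(7) s by (intro add_left_mono mult_left_mono) auto
    also have "\<dots> = L * ww" by (simp add: algebra_simps)
    also have "\<dots> \<le> L * (2 * (L - \<sigma>) * Dh)" using * s by (intro mult_left_mono) auto
    finally have "(L - \<sigma>) * (ww + 2 * \<sigma> * wd - \<sigma> * (L - \<sigma>) * dd) \<le> (L - \<sigma>) * (2 * L * Dh)"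
      by (simp add: algebra_simps)
    then have "ww + 2 * \<sigma> * wd - \<sigma> * (L - \<sigma>) * dd \<le> 2 * L * Dh"
      using M by simp
    then have "\<theta> * (ww + 2 * \<sigma> * wd - \<sigma> * (L - \<sigma>) * dd) \<le> \<theta> * (2 * L * Dh)"
      using \<theta> by (intro mult_left_mono) auto
    also have "\<dots> = (2 * \<theta> * L) * Dh" by simp
    also have "\<dots> \<le> 1 * Dh" using \<theta> * by (intro mult_right_mono) auto
    finally show ?thesis by simp
  qed
  then show ?thesis
    unfolding *(1)[folded dd_def] *(2) dd_def[symmetric]
    by (simp add: algebra_simps power2_eq_square)
qed

text \<open>For \<open>\<theta> = 1 / (2 * (L + \<sigma>))\<close> this is the sharp two-term bound
\<open>\<sigma> L / (2 (L + \<sigma>)) * \<bar>y - x\<bar>\<^sup>2 + \<bar>G y - G x\<bar>\<^sup>2 / (2 (L + \<sigma>))\<close>.  Stating the condition on \<open>\<theta>\<close> without a division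
includes \<open>\<sigma> = - L\<close>, where that bound degenerates.\<close>

lemma bregman_lower_bound_nonpos:
  fixes F :: "'a::real_inner \<Rightarrow> real"
  assumes grad: "\<And>x. GDERIV F x :> G x" and lip: "lipschitz_on L UNIV G"
    and hypo: "hypoconvex \<sigma> F" and s: "\<sigma> \<le> 0" "0 < L" and \<theta>: "0 \<le> \<theta>" "2 * \<theta> * (L + \<sigma>) \<le> 1"
  shows "\<sigma> / 2 * (norm (y - x))\<^sup>2 + \<theta> * ((norm (G y - G x))\<^sup>2 - \<sigma>\<^sup>2 * (norm (y - x))\<^sup>2)
    \<le> F y - F x - inner (G x) (y - x)"
proof -
  have le: "\<sigma> \<le> L" and M: "0 < L - \<sigma>" using s by auto
  define dd where "dd = (norm (y - x))\<^sup>2"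
  obtain Dh ww wd where *:
    "F y - F x - inner (G x) (y - x) = \<sigma> / 2 * dd + Dh"
    "(norm (G y - G x))\<^sup>2 = ww + 2 * \<sigma> * wd + \<sigma>\<^sup>2 * dd"
    "0 \<le> ww" "0 \<le> Dh" "ww \<le> 2 * (L - \<sigma>) * Dh" "ww \<le> (L - \<sigma>) * wd"
    unfolding dd_def by (rule hypoconvex_smooth_bregman[OF grad lip hypo le, of y x])
  have "(L - \<sigma>) * (\<theta> * (ww + 2 * \<sigma> * wd)) = \<theta> * ((L - \<sigma>) * ww + 2 * \<sigma> * ((L - \<sigma>) * wd))"
    by (simp add: algebra_simps)
  also have "\<dots> \<le> \<theta> * ((L - \<sigma>) * ww + 2 * \<sigma> * ww)"
    using * s \<theta> by (intro mult_left_mono add_left_mono mult_left_mono_neg) auto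
  also have "\<dots> = (2 * \<theta> * (L + \<sigma>)) * (ww / 2)" by (simp add: algebra_simps)
  also have "\<dots> \<le> 1 * (ww / 2)" using * \<theta> by (intro mult_right_mono) auto
  also have "\<dots> \<le> (L - \<sigma>) * Dh" using *(5) by (simp add: algebra_simps)
  finally have "\<theta> * (ww + 2 * \<sigma> * wd) \<le> Dh" using M by simp
  then show ?thesis
    unfolding *(1)[folded dd_def] *(2) dd_def[symmetric] by (simp add: algebra_simps)
qed

section \<open>The admissible stepsizes and relaxations\<close>

text \<open>The stepsize lies strictly between the roots of \<open>2 \<sigma> L \<gamma>\<^sup>2 - \<sigma> \<lambda> \<gamma> + (\<lambda> - 2)\<close>, and \<open>c\<close> is this quadratic up
to a negative factor.  The square root of a negative number being negative, a nonempty range of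
stepsizes forces a positive discriminant.  The two other bounds follow from
\<open>\<delta> \<le> p1 * lam\<close> and \<open>\<delta> \<le> p1 * (4 - lam)\<close>.\<close>

lemma step_constant_bounds_lam_ge_2:
  fixes \<beta> L \<sigma> p1 \<gamma> \<delta> lam c :: real
  assumes L: "L > 0" and s: "\<sigma> > 0" "\<sigma> \<le> L" and p1: "p1 = \<sigma> / L" and \<gamma>: "\<gamma> > 0"
    and delta: "\<delta> = sqrt ((p1 * lam)\<^sup>2 - 8 * p1 * (lam - 2))"
    and lam: "2 \<le> lam" "lam < 4 / (1 + sqrt (1 - p1))"
    and range: "(p1 * lam - \<delta>) / (4 * \<sigma>) < \<gamma>" "\<gamma> < (p1 * lam + \<delta>) / (4 * \<sigma>)"
    and c: "c = (2 - lam) / (2 * lam * \<gamma>) + \<sigma> * (1 / 2 - \<gamma> * L / lam)"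
  shows "0 < c" "\<gamma> * L < 1" "2 * (\<gamma> / lam) * L \<le> 1"
proof -
  have p: "0 < p1" "p1 \<le> 1" "p1 * L = \<sigma>" using L s p1 by auto
  have sg: "0 < 4 * \<sigma>" using s by simp
  have lo: "p1 * lam - \<delta> < 4 * \<sigma> * \<gamma>" and hi: "4 * \<sigma> * \<gamma> < p1 * lam + \<delta>"
    using range sg by (simp_all add: pos_divide_less_eq pos_less_divide_eq mult.commute)
  have dpos: "0 < \<delta>" using lo hi by simp
  then have arg: "\<delta>\<^sup>2 = (p1 * lam)\<^sup>2 - 8 * p1 * (lam - 2)"
    using delta by (simp add: real_sqrt_gt_0_iff)
  have "(4 * \<sigma> * \<gamma> - p1 * lam)\<^sup>2 < \<delta>\<^sup>2"
    using lo hi by (intro power2_strict_mono) auto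
  then have "4 * (4 * \<sigma>\<^sup>2 * \<gamma>\<^sup>2 - 2 * \<sigma> * \<gamma> * p1 * lam + 2 * p1 * (lam - 2)) < 0"
    unfolding arg by (simp add: power2_eq_square algebra_simps)
  also have "4 * \<sigma>\<^sup>2 * \<gamma>\<^sup>2 - 2 * \<sigma> * \<gamma> * p1 * lam + 2 * p1 * (lam - 2)
      = 2 * p1 * (2 * \<sigma> * L * \<gamma>\<^sup>2 - \<sigma> * \<gamma> * lam + (lam - 2))"
    by (simp add: p(3)[symmetric] power2_eq_square algebra_simps)
  finally have key: "2 * \<sigma> * L * \<gamma>\<^sup>2 - \<sigma> * \<gamma> * lam + (lam - 2) < 0"
    using p by (simp add: mult_less_0_iff)
  have "c = - (2 * \<sigma> * L * \<gamma>\<^sup>2 - \<sigma> * \<gamma> * lam + (lam - 2)) / (2 * lam * \<gamma>)"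
    using \<gamma> lam by (simp add: c field_simps power2_eq_square)
  then show "0 < c" using key \<gamma> lam by (simp add: divide_neg_pos)
  have "\<delta>\<^sup>2 \<le> (p1 * lam)\<^sup>2" unfolding arg using p lam by simp
  then have "\<delta> \<le> p1 * lam" using p lam by (simp add: power2_le_iff_abs_le)
  then have "4 * \<sigma> * \<gamma> < 2 * (p1 * lam)" using hi by linarith
  then have "p1 * (2 * (L * \<gamma>)) < p1 * lam" by (simp add: p(3)[symmetric] ac_simps)
  then have "2 * (L * \<gamma>) < lam" using p by simp
  then show "2 * (\<gamma> / lam) * L \<le> 1" using lam by (simp add: field_simps)
  have "lam \<le> 4"
  proof -
    have "4 / (1 + sqrt (1 - p1)) \<le> 4 / 1" using p by (intro divide_left_mono) (auto intro: add_pos_nonneg)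
    then show ?thesis using lam by linarith
  qed
  have "\<delta>\<^sup>2 \<le> (p1 * (4 - lam))\<^sup>2"
  proof -
    have "(p1 * (4 - lam))\<^sup>2 - \<delta>\<^sup>2 = 8 * p1 * (lam - 2) * (1 - p1)"
      unfolding arg by (simp add: power2_eq_square algebra_simps)
    moreover have "0 \<le> 8 * p1 * (lam - 2) * (1 - p1)" using p lam by simp
    ultimately show ?thesis by linarith
  qed
  then have "\<delta> \<le> p1 * (4 - lam)" using p \<open>lam \<le> 4\<close> by (simp add: power2_le_iff_abs_le)
  then have "p1 * (4 * (\<gamma> * L)) < p1 * 4" using hi by (simp add: p(3)[symmetric] algebra_simps)
  then show "\<gamma> * L < 1" using p by simp
qed

text \<open>If \<open>p1 \<ge> \<lambda> / 2 - 1\<close>, each of the two terms of the maximum is compared with \<open>(2 - \<lambda>) / (2 \<lambda> \<gamma>)\<close>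
using \<open>\<gamma> L < 1\<close>: for the first one this
case distinction is exactly what the comparison requires; for the second one the
quadratic \<open>2 t\<^sup>2 - \<lambda> t - (2 - \<lambda>)\<close> in \<open>t = \<gamma> L\<close> is negative because it factors
as \<open>(t - 1) (2 t + 2 - \<lambda>)\<close>.\<close>

lemma step_constant_pos_lam_less_2:
  fixes L \<sigma> p1 \<gamma> lam c :: real
  assumes L: "L > 0"
    and \<gamma>: "0 < \<gamma>" "\<gamma> * L < 1" "2 * \<gamma> * neg_part \<sigma> < 2 - lam" and lam: "0 < lam" "lam < 2"
    and c: "c = (2 - lam) / (2 * lam * \<gamma>) -
            (if p1 \<ge> lam / 2 - 1
             then L * max (neg_part p1 / (2 * (1 - neg_part p1))) (\<gamma> * L / lam - 1 / 2)
             else neg_part \<sigma> / lam)"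
  shows "0 < c"
proof (cases "p1 \<ge> lam / 2 - 1")
  case True
  define p where "p = neg_part p1"
  have p: "0 \<le> p" "2 * p \<le> 2 - lam" using True lam by (auto simp: p_def neg_part_def)
  then have "p < 1" using lam by simp
  have "(2 - lam) / (2 * lam) * L < (2 - lam) / (2 * lam) * (1 / \<gamma>)"
    using \<gamma> lam by (intro mult_strict_left_mono) (auto simp: field_simps)
  then have big: "(2 - lam) / (2 * lam) * L < (2 - lam) / (2 * lam * \<gamma>)" by simp
  have "p * lam \<le> (2 - lam) * (1 - p)" using p by (simp add: algebra_simps)
  then have "p / (2 * (1 - p)) \<le> (2 - lam) / (2 * lam)"
    using lam \<open>p < 1\<close> by (simp add: field_simps)
  then have 1: "L * (p / (2 * (1 - p))) < (2 - lam) / (2 * lam * \<gamma>)"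
    using big L by (smt (verit) mult.commute mult_left_mono)
  have "(\<gamma> * L - 1) * (2 * (\<gamma> * L) + (2 - lam)) < 0"
    using \<gamma> lam L by (intro mult_neg_pos add_pos_pos) auto
  then have "\<gamma> * L * (2 * (\<gamma> * L) - lam) < 2 - lam" by (simp add: algebra_simps)
  then have "\<gamma> * L * (2 * (\<gamma> * L) - lam) / (2 * lam * \<gamma>) < (2 - lam) / (2 * lam * \<gamma>)"
    using \<gamma> lam by (intro divide_strict_right_mono) auto
  moreover have "\<gamma> * L * (2 * (\<gamma> * L) - lam) / (2 * lam * \<gamma>) = L * (\<gamma> * L / lam - 1 / 2)"
    using \<gamma> lam by (simp add: field_simps)
  ultimately have "L * (\<gamma> * L / lam - 1 / 2) < (2 - lam) / (2 * lam * \<gamma>)" by simp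
  with 1 have "L * max (p / (2 * (1 - p))) (\<gamma> * L / lam - 1 / 2) < (2 - lam) / (2 * lam * \<gamma>)"
    by (simp add: max_def)
  then show ?thesis using True by (simp add: c p_def)
next
  case False
  have "neg_part \<sigma> / lam < (2 - lam) / (2 * lam * \<gamma>)"
    using \<gamma> lam by (simp add: field_simps)
  then show ?thesis using False by (simp add: c)
qed

text \<open>The choice of \<open>\<theta>\<close> in the lower bounds for the tangent gap.  If the largest \<open>\<theta>\<close> is taken, the remaining
coefficient \<open>\<gamma> / \<lambda> - \<theta>\<close> of \<open>\<bar>G y - G x\<bar>\<^sup>2\<close> may have either sign; this is the maximum in the constant.
If \<open>p1 < \<lambda> / 2 - 1\<close>, then \<open>\<theta> = \<gamma> / \<lambda>\<close> is admissible and cancels that term.\<close>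

lemma step_gap_lam_less_2:
  fixes F :: "'a::real_inner \<Rightarrow> real"
  assumes grad: "\<And>x. GDERIV F x :> G x" and lip: "lipschitz_on L UNIV G"
    and hypo: "hypoconvex \<sigma> F" and L: "L > 0" and s: "\<sigma> \<in> {-L..L}" and p1: "p1 = \<sigma> / L"
    and \<gamma>: "0 < \<gamma>" "\<gamma> * L < 1" "2 * \<gamma> * neg_part \<sigma> < 2 - lam" and lam: "0 < lam" "lam < 2"
  shows "\<gamma> / lam * (norm (G y - G x))\<^sup>2 - (F y - F x - inner (G x) (y - x))
    \<le> (if p1 \<ge> lam / 2 - 1
        then L * max (neg_part p1 / (2 * (1 - neg_part p1))) (\<gamma> * L / lam - 1 / 2)
        else neg_part \<sigma> / lam) * (norm (y - x))\<^sup>2"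
proof -
  define D where "D = F y - F x - inner (G x) (y - x)"
  define dd where "dd = (norm (y - x))\<^sup>2"
  define ee where "ee = (norm (G y - G x))\<^sup>2"
  have nn: "0 \<le> dd" "0 \<le> ee" by (simp_all add: dd_def ee_def)
  have "norm (G y - G x) \<le> L * norm (y - x)"
    using lipschitz_onD[OF lip, of y x] by (simp add: dist_norm)
  then have "(norm (G y - G x))\<^sup>2 \<le> (L * norm (y - x))\<^sup>2" by (intro power_mono) auto
  then have ee: "ee \<le> L\<^sup>2 * dd" by (simp add: ee_def dd_def power_mult_distrib)
  have mix: "\<gamma> / lam * ee - D \<le> L * max q (\<gamma> * L / lam - 1 / 2) * dd"
    if D: "\<theta> * ee - L * q * dd \<le> D" and q: "L * q = \<theta> * L\<^sup>2 - L / 2" for \<theta> q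
  proof (cases "\<gamma> / lam \<le> \<theta>")
    case True
    have "\<gamma> / lam * ee - D \<le> (\<gamma> / lam - \<theta>) * ee + L * q * dd" using D by (simp add: algebra_simps)
    also have "\<dots> \<le> L * q * dd" using True nn by (simp add: mult_nonpos_nonneg)
    also have "\<dots> \<le> L * max q (\<gamma> * L / lam - 1 / 2) * dd"
      using L nn by (intro mult_right_mono mult_left_mono) auto
    finally show ?thesis .
  next
    case False
    have "\<gamma> / lam * ee - D \<le> (\<gamma> / lam - \<theta>) * ee + L * q * dd" using D by (simp add: algebra_simps)
    also have "\<dots> \<le> (\<gamma> / lam - \<theta>) * (L\<^sup>2 * dd) + L * q * dd"
      using False ee by (intro add_right_mono mult_left_mono) auto
    also have "\<dots> = L * (\<gamma> * L / lam - 1 / 2) * dd"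
      unfolding q by (simp add: algebra_simps power2_eq_square)
    also have "\<dots> \<le> L * max q (\<gamma> * L / lam - 1 / 2) * dd"
      using L nn by (intro mult_right_mono mult_left_mono) auto
    finally show ?thesis .
  qed
  consider (convex) "\<sigma> \<ge> 0" | (weak) "\<sigma> < 0" "p1 \<ge> lam / 2 - 1" | (strong) "\<sigma> < 0" "p1 < lam / 2 - 1"
    by linarith
  then have "\<gamma> / lam * ee - D \<le> (if p1 \<ge> lam / 2 - 1
        then L * max (neg_part p1 / (2 * (1 - neg_part p1))) (\<gamma> * L / lam - 1 / 2)
        else neg_part \<sigma> / lam) * dd"
  proof cases
    case convex
    then have "0 \<le> p1" using L p1 by simp
    then have p: "neg_part p1 = 0" "p1 \<ge> lam / 2 - 1" using lam by (auto simp: neg_part_def)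
    have "\<sigma> / 2 * dd + 1 / (2 * L) * (ee - \<sigma> * L * dd) \<le> D"
      unfolding dd_def ee_def D_def
      by (rule bregman_lower_bound_nonneg[OF grad lip hypo]) (use convex s L in auto)
    then have "1 / (2 * L) * ee - L * 0 * dd \<le> D" using L by (simp add: field_simps)
    from mix[OF this] show ?thesis using p L by (simp add: power2_eq_square)
  next
    case weak
    have "L * (lam / 2 - 1) \<le> \<sigma>" using weak L p1 by (simp add: field_simps)
    then have "L * lam / 2 \<le> L + \<sigma>" by (simp add: algebra_simps)
    moreover have "0 < L * lam" using L lam by simp
    ultimately have Ls: "0 < L + \<sigma>" by linarith
    have np: "neg_part p1 = - \<sigma> / L" using weak p1 L by (simp add: neg_part_def max_def divide_le_0_iff)
    define \<theta> where "\<theta> = 1 / (2 * (L + \<sigma>))"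
    define q where "q = neg_part p1 / (2 * (1 - neg_part p1))"
    have \<theta>: "2 * \<theta> * (L + \<sigma>) = 1" using Ls by (simp add: \<theta>_def)
    have "q = (- \<sigma> / L) / (2 * ((L + \<sigma>) / L))" using L by (simp add: q_def np field_simps)
    also have "\<dots> = - \<sigma> * \<theta>" using L Ls by (simp add: \<theta>_def field_simps)
    finally have q: "q = - \<sigma> * \<theta>" .
    have q1: "L * q = \<theta> * L\<^sup>2 - L / 2"
    proof -
      have "L * q - \<theta> * L\<^sup>2 = - L * (2 * \<theta> * (L + \<sigma>)) / 2"
        unfolding q by (simp add: algebra_simps power2_eq_square)
      then show ?thesis unfolding \<theta> by simp
    qed
    have q2: "L * q = \<theta> * \<sigma>\<^sup>2 - \<sigma> / 2"
    proof -
      have "L * q - \<theta> * \<sigma>\<^sup>2 = - \<sigma> * (2 * \<theta> * (L + \<sigma>)) / 2"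
        unfolding q by (simp add: algebra_simps power2_eq_square)
      then show ?thesis unfolding \<theta> by simp
    qed
    have "\<sigma> / 2 * dd + \<theta> * (ee - \<sigma>\<^sup>2 * dd) \<le> D"
      unfolding dd_def ee_def D_def
      by (rule bregman_lower_bound_nonpos[OF grad lip hypo]) (use weak L \<theta> Ls in \<open>auto simp: \<theta>_def\<close>)
    then have "\<theta> * ee - L * q * dd \<le> D" unfolding q2 by (simp add: algebra_simps)
    from mix[OF this q1] show ?thesis using weak by (simp add: q_def)
  next
    case strong
    have np: "neg_part \<sigma> = - \<sigma>" using strong by (simp add: neg_part_def)
    have "\<sigma> < L * (lam / 2 - 1)" using strong L p1 by (simp add: field_simps)
    then have "2 * (L + \<sigma>) < lam * L" by (simp add: algebra_simps)
    have "2 * (\<gamma> / lam) * (L + \<sigma>) \<le> 1"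
    proof -
      have "\<gamma> * (2 * (L + \<sigma>)) \<le> \<gamma> * (lam * L)"
        using \<open>2 * (L + \<sigma>) < lam * L\<close> \<gamma> by (intro mult_left_mono) auto
      also have "\<dots> = lam * (\<gamma> * L)" by simp
      also have "\<dots> \<le> lam * 1" using \<gamma> lam by (intro mult_left_mono) auto
      finally show ?thesis using lam by (simp add: field_simps)
    qed
    then have "\<sigma> / 2 * dd + (\<gamma> / lam) * (ee - \<sigma>\<^sup>2 * dd) \<le> D"
      unfolding dd_def ee_def D_def
      by (intro bregman_lower_bound_nonpos[OF grad lip hypo]) (use strong L \<gamma> lam in auto)
    then have "\<gamma> / lam * ee - D \<le> (\<gamma> / lam * \<sigma>\<^sup>2 - \<sigma> / 2) * dd" by (simp add: algebra_simps)
    also have "\<dots> \<le> neg_part \<sigma> / lam * dd"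
    proof (intro mult_right_mono nn)
      have "- \<sigma> * (2 * \<gamma> * (- \<sigma>)) \<le> - \<sigma> * (2 - lam)"
        using strong \<gamma> np by (intro mult_left_mono) auto
      then have "2 * \<gamma> * \<sigma>\<^sup>2 - \<sigma> * lam \<le> - 2 * \<sigma>" by (simp add: power2_eq_square algebra_simps)
      then show "\<gamma> / lam * \<sigma>\<^sup>2 - \<sigma> / 2 \<le> neg_part \<sigma> / lam"
        unfolding np using lam divide_right_mono[of "2 * \<gamma> * \<sigma>\<^sup>2 - \<sigma> * lam" "- 2 * \<sigma>" "2 * lam"]
        by (simp add: diff_divide_distrib)
    qed
    finally show ?thesis using strong by simp
  qed
  then show ?thesis by (simp add: D_def dd_def ee_def)
qed

lemma relaxation_gain:
  fixes F :: "'a::real_inner \<Rightarrow> real"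
  assumes grad: "\<And>x. GDERIV F x :> G x" and lip: "lipschitz_on L UNIV G"
    and hypo: "hypoconvex \<sigma> F" and L: "L > 0" and s: "\<sigma> \<in> {-L..L}" and p1: "p1 = \<sigma> / L"
    and \<gamma>: "0 < \<gamma>"
    and delta: "\<delta> = sqrt ((p1 * lam)\<^sup>2 - 8 * p1 * (lam - 2))"
    and lam: "lam > 0"
    and params:
      "(lam < 2 \<and>
        ereal \<gamma> < min (ereal (2 - lam) / ereal (2 * neg_part \<sigma>)) (ereal (1 / L)) \<and>
        c = (2 - lam) / (2 * lam * \<gamma>) -
            (if p1 \<ge> lam / 2 - 1
             then L * max (neg_part p1 / (2 * (1 - neg_part p1))) (\<gamma> * L / lam - 1 / 2)
             else neg_part \<sigma> / lam))
       \<or>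
       (\<sigma> > 0 \<and> 2 \<le> lam \<and> lam < 4 / (1 + sqrt (1 - p1)) \<and>
        (p1 * lam - \<delta>) / (4 * \<sigma>) < \<gamma> \<and> \<gamma> < (p1 * lam + \<delta>) / (4 * \<sigma>) \<and>
        c = (2 - lam) / (2 * lam * \<gamma>) + \<sigma> * (1 / 2 - \<gamma> * L / lam))"
  shows "0 < c" and "\<gamma> * L < 1"
    and "\<And>x y. \<gamma> / lam * (norm (G y - G x))\<^sup>2 - (F y - F x - inner (G x) (y - x))
      - (2 - lam) / (2 * lam * \<gamma>) * (norm (y - x))\<^sup>2 \<le> - c * (norm (y - x))\<^sup>2"
proof -
  have "0 < c \<and> \<gamma> * L < 1 \<and> (\<forall>x y. \<gamma> / lam * (norm (G y - G x))\<^sup>2 - (F y - F x - inner (G x) (y - x))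
      - (2 - lam) / (2 * lam * \<gamma>) * (norm (y - x))\<^sup>2 \<le> - c * (norm (y - x))\<^sup>2)"
    using params
  proof (elim disjE conjE)
    let ?K = "if p1 \<ge> lam / 2 - 1
             then L * max (neg_part p1 / (2 * (1 - neg_part p1))) (\<gamma> * L / lam - 1 / 2)
             else neg_part \<sigma> / lam"
    assume lam2: "lam < 2" and g: "ereal \<gamma> < min (ereal (2 - lam) / ereal (2 * neg_part \<sigma>)) (ereal (1 / L))"
      and c: "c = (2 - lam) / (2 * lam * \<gamma>) - ?K"
    have gL: "\<gamma> * L < 1" using g L by (simp add: field_simps)
    have gs: "2 * \<gamma> * neg_part \<sigma> < 2 - lam"
    proof (cases "neg_part \<sigma> = 0")
      case True
      then show ?thesis using lam2 by simp
    next
      case False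
      then have "neg_part \<sigma> > 0" by (simp add: neg_part_def max_def split: if_splits)
      then show ?thesis using g by (simp add: field_simps)
    qed
    have "0 < c" by (rule step_constant_pos_lam_less_2[OF L \<gamma> gL gs lam lam2 c])
    moreover have "\<gamma> / lam * (norm (G y - G x))\<^sup>2 - (F y - F x - inner (G x) (y - x))
      - (2 - lam) / (2 * lam * \<gamma>) * (norm (y - x))\<^sup>2 \<le> - c * (norm (y - x))\<^sup>2" for x y
      using step_gap_lam_less_2[OF grad lip hypo L s p1 \<gamma> gL gs lam lam2, of y x]
      unfolding c by (simp only: left_diff_distrib minus_diff_eq minus_mult_left[symmetric])
    ultimately show ?thesis using gL by blast
  next
    assume sg: "\<sigma> > 0" and lam2: "2 \<le> lam" "lam < 4 / (1 + sqrt (1 - p1))"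
      and r: "(p1 * lam - \<delta>) / (4 * \<sigma>) < \<gamma>" "\<gamma> < (p1 * lam + \<delta>) / (4 * \<sigma>)"
      and c: "c = (2 - lam) / (2 * lam * \<gamma>) + \<sigma> * (1 / 2 - \<gamma> * L / lam)"
    have sL: "\<sigma> \<le> L" using s by simp
    note b = step_constant_bounds_lam_ge_2[OF L sg sL p1 \<gamma> delta lam2 r c]
    have "\<gamma> / lam * (norm (G y - G x))\<^sup>2 - (F y - F x - inner (G x) (y - x))
      - (2 - lam) / (2 * lam * \<gamma>) * (norm (y - x))\<^sup>2 \<le> - c * (norm (y - x))\<^sup>2" for x y
    proof -
      have "\<sigma> / 2 * (norm (y - x))\<^sup>2 + \<gamma> / lam * ((norm (G y - G x))\<^sup>2 - \<sigma> * L * (norm (y - x))\<^sup>2)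
        \<le> F y - F x - inner (G x) (y - x)"
        by (rule bregman_lower_bound_nonneg[OF grad lip hypo _ sL _ b(3)]) (use sg \<gamma> lam in auto)
      then show ?thesis unfolding c by (simp add: algebra_simps)
    qed
    then show ?thesis using b by blast
  qed
  then show "0 < c" "\<gamma> * L < 1"
    "\<And>x y. \<gamma> / lam * (norm (G y - G x))\<^sup>2 - (F y - F x - inner (G x) (y - x))
      - (2 - lam) / (2 * lam * \<gamma>) * (norm (y - x))\<^sup>2 \<le> - c * (norm (y - x))\<^sup>2"
    by blast+
qed

section \<open>Optimality in quadratically penalized subproblems\<close>

text \<open>The first-order condition at a minimizer of \<open>h\<close> plus a quadratic, tested in the single direction \<open>D + p\<close>.\<close>

lemma GDERIV_eq_of_quadratic_minorant:
  fixes h :: "'a::real_inner \<Rightarrow> real"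
  assumes grad: "GDERIV h x :> D"
    and min: "\<And>s. h x \<le> h s + inner p (s - x) + M / 2 * (norm (s - x))\<^sup>2"
  shows "D = - p"
proof -
  define d where "d = D + p"
  define \<phi> where "\<phi> t = h (x + t *\<^sub>R d) + t * inner p d + M / 2 * t\<^sup>2 * (norm d)\<^sup>2" for t
  have "((\<lambda>t. h (x + t *\<^sub>R d)) has_real_derivative inner D d) (at 0)"
    using grad by (intro GDERIV_along_line) simp
  then have "(\<phi> has_real_derivative (inner D d + inner p d)) (at 0)"
    unfolding \<phi>_def by (auto intro!: derivative_eq_intros)
  moreover have "\<phi> 0 \<le> \<phi> t" for t
    using min[of "x + t *\<^sub>R d"] by (simp add: \<phi>_def power_mult_distrib)
  ultimately have "inner D d + inner p d = 0"
    by (intro DERIV_local_min[of \<phi> _ 0 1]) auto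
  then have "inner d d = 0" by (simp add: d_def inner_add_left)
  then show ?thesis by (simp add: d_def eq_neg_iff_add_eq_0)
qed

text \<open>Recentring the penalty at the current residual turns the multiplier \<open>q\<close> into the updated multiplier
\<open>q + \<beta> r\<close>; this is why the multiplier update makes \<open>- y\<close> a gradient.\<close>

lemma augmented_quadratic_shift:
  fixes q r a :: "'a::real_inner"
  shows "inner q (r + a) + \<beta> / 2 * (norm (r + a))\<^sup>2
    = (inner q r + \<beta> / 2 * (norm r)\<^sup>2) + (inner (q + \<beta> *\<^sub>R r) a + \<beta> / 2 * (norm a)\<^sup>2)"
  using norm_add_scaleR_sq[of r 1 a]
  by (simp add: inner_add_left inner_add_right algebra_simps)

lemma argmin_set_le:
  fixes h :: "'a \<Rightarrow> 'b::linorder"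
  assumes "x \<in> argmin_set h" shows "h x \<le> h u"
  using assms by (auto simp: argmin_set_def is_arg_min_linorder)

lemma x_update_optimality:
  assumes "x' \<in> argmin_set (\<lambda>u. aug_lagrangian f (\<lambda>_. 0) A B b \<beta> u z q)"
  shows "f x' \<le> f u + inner (q + \<beta> *\<^sub>R residual A B b x' z) (A *v (u - x'))
    + \<beta> / 2 * (norm (A *v (u - x')))\<^sup>2"
proof -
  have "residual A B b u z = residual A B b x' z + A *v (u - x')"
    by (simp add: residual_def matrix_vector_mult_diff_distrib)
  then show ?thesis
    using argmin_set_le[OF assms, of u] augmented_quadratic_shift[of q "residual A B b x' z" "A *v (u - x')" \<beta>]
    by (simp add: aug_lagrangian_def)
qed

lemma z_update_optimality:
  assumes z': "z' \<in> argmin_set (\<lambda>w. aug_lagrangian f g A B b \<beta> x w q)" and fin: "\<bar>g z'\<bar> \<noteq> \<infinity>"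
  shows "g z' \<le> g w + ereal (inner (q + \<beta> *\<^sub>R residual A B b x z') (B *v (w - z'))
    + \<beta> / 2 * (norm (B *v (w - z')))\<^sup>2)"
proof -
  have "residual A B b x w = residual A B b x z' + B *v (w - z')"
    by (simp add: residual_def matrix_vector_mult_diff_distrib)
  then show ?thesis
    using argmin_set_le[OF z', of w] augmented_quadratic_shift[of q "residual A B b x z'" "B *v (w - z')" \<beta>] fin
    by (cases "g w"; cases "g z'") (auto simp: aug_lagrangian_def)
qed

lemma z_update_finite:
  assumes z': "z' \<in> argmin_set (\<lambda>w. aug_lagrangian f g A B b \<beta> x w q)" and g: "proper g"
  shows "\<bar>g z'\<bar> \<noteq> \<infinity>"
proof -
  obtain w where "g w \<noteq> \<infinity>" "g w \<noteq> -\<infinity>" "g z' \<noteq> -\<infinity>" using g by (auto simp: proper_def)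
  then show ?thesis
    using argmin_set_le[OF z', of w] by (cases "g w"; cases "g z'") (auto simp: aug_lagrangian_def)
qed

text \<open>The difference quotient is bounded below by a quadratic term divided by \<open>\<bar>u - x\<bar>\<close>, which tends to \<open>0\<close>.\<close>

lemma regular_subgradient_of_quadratic_minorant:
  fixes h :: "real^'m \<Rightarrow> ereal" and C :: "real^'m^'p"
  assumes fin: "\<bar>h x\<bar> \<noteq> \<infinity>" and \<beta>: "0 \<le> \<beta>"
    and min: "\<And>u. h x \<le> h u + ereal (inner p (C *v (u - x)) + \<beta> / 2 * (norm (C *v (u - x)))\<^sup>2)"
  shows "- (transpose C *v p) \<in> regular_subdiff h x"
proof -
  obtain K where K: "\<And>v. norm (C *v v) \<le> norm v * K"
    using bounded_linear.pos_bounded[OF matrix_vector_mul_bounded_linear[of C]] by blast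
  obtain hx where hx: "h x = ereal hx" using fin by (cases "h x") auto
  define Q where "Q u = (h u - h x - ereal (inner (- (transpose C *v p)) (u - x))) / ereal (norm (u - x))" for u
  have low: "ereal (- (\<beta> / 2 * K\<^sup>2 * norm (u - x))) \<le> Q u" if "u \<noteq> x" for u
  proof (cases "h u")
    case (real hu)
    have "(norm (C *v (u - x)))\<^sup>2 \<le> (norm (u - x) * K)\<^sup>2" using K by (intro power_mono) auto
    then have "\<beta> / 2 * (norm (C *v (u - x)))\<^sup>2 \<le> \<beta> / 2 * (norm (u - x) * K)\<^sup>2"
      using \<beta> by (intro mult_left_mono) auto
    then have "hx \<le> hu + inner p (C *v (u - x)) + \<beta> / 2 * (norm (u - x) * K)\<^sup>2"
      using min[of u] by (simp add: real hx)
    then have "- (\<beta> / 2 * K\<^sup>2 * norm (u - x)) * norm (u - x) \<le> hu - hx + inner p (C *v (u - x))"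
      by (simp add: power_mult_distrib power2_eq_square mult_ac)
    then have "- (\<beta> / 2 * K\<^sup>2 * norm (u - x)) \<le> (hu - hx + inner p (C *v (u - x))) / norm (u - x)"
      using that by (subst pos_le_divide_eq) auto
    then show ?thesis using that by (simp add: Q_def hx real transpose_matrix_vector dot_lmul_matrix)
  next
    case PInf
    then show ?thesis using that by (simp add: Q_def hx)
  next
    case MInf
    then show ?thesis using min[of u] hx by simp
  qed
  have "((\<lambda>u. ereal (- (\<beta> / 2 * K\<^sup>2 * norm (u - x)))) \<longlongrightarrow> ereal (- (\<beta> / 2 * K\<^sup>2 * norm (x - x)))) (at x)"
    by (intro tendsto_intros)
  then have "Liminf (at x) (\<lambda>u. ereal (- (\<beta> / 2 * K\<^sup>2 * norm (u - x)))) = 0"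
    by (intro lim_imp_Liminf) (auto simp: zero_ereal_def)
  moreover have "Liminf (at x) (\<lambda>u. ereal (- (\<beta> / 2 * K\<^sup>2 * norm (u - x)))) \<le> Liminf (at x) Q"
    by (rule Liminf_mono, unfold eventually_at_filter) (intro always_eventually allI impI low)
  ultimately show ?thesis using fin unfolding regular_subdiff_def Q_def by simp
qed

section \<open>Lower semicontinuity and minima of square summable sequences\<close>

text \<open>The punctured neighbourhoods in the definition of lower semicontinuity do no harm when the
sequence visits its limit, since the bound that is violated also holds at the limit itself.\<close>

lemma lsc_sequentially:
  assumes "lsc h" and xs: "xs \<longlonglongrightarrow> l" and lim: "(\<lambda>k. h (xs k)) \<longlonglongrightarrow> c"
  shows "h l \<le> c"
proof (rule ccontr)
  assume "\<not> h l \<le> c"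
  then obtain t where t: "c < t" "t < h l" using dense by (auto simp: not_le)
  then have "t < Liminf (at l) h" using assms(1) by (auto simp: lsc_def intro: less_le_trans)
  then have "\<forall>\<^sub>F u in at l. t < h u" by (rule less_LiminfD)
  then have "\<forall>\<^sub>F u in nhds l. t < h u" using t by (simp add: eventually_nhds_conv_at)
  then have "\<forall>\<^sub>F k in sequentially. t < h (xs k)"
    using xs by (auto simp: filterlim_iff)
  then have "t \<le> c"
    by (intro tendsto_lowerbound[OF lim]) (auto elim: eventually_mono)
  then show False using t by simp
qed

text \<open>The running minimum is below each of the last \<open>k / 2\<close> terms, so \<open>k / 2\<close> times its square is at most a
tail of the series.\<close>

lemma Min_smallo_of_summable_squares:
  fixes a :: "nat \<Rightarrow> real"
  assumes pos: "\<And>k. 0 \<le> a k" and sum: "summable (\<lambda>k. (a k)\<^sup>2)"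
  shows "(\<lambda>k. Min (a ` {..k})) \<in> o(\<lambda>k. 1 / sqrt (real k))"
proof (rule landau_o.smallI)
  fix e :: real assume e: "e > 0"
  have "0 < e\<^sup>2 / 2" using e by simp
  with sum obtain N where N: "\<And>m n. m \<ge> N \<Longrightarrow> norm (\<Sum>k=m..<n. (a k)\<^sup>2) < e\<^sup>2 / 2"
    unfolding summable_Cauchy by meson
  show "\<forall>\<^sub>F k in sequentially. norm (Min (a ` {..k})) \<le> e * norm (1 / sqrt (real k))"
  proof (rule eventually_sequentiallyI)
    fix k assume k: "max 1 (2 * N) \<le> k"
    define m where "m = Min (a ` {..k})"
    have m0: "0 \<le> m" using pos by (auto simp: m_def)
    have "real k / 2 * m\<^sup>2 \<le> real (card {N..<Suc k}) * m\<^sup>2"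
      using k by (intro mult_right_mono) (auto simp: of_nat_diff)
    also have "\<dots> = (\<Sum>i=N..<Suc k. m\<^sup>2)" by simp
    also have "\<dots> \<le> (\<Sum>i=N..<Suc k. (a i)\<^sup>2)"
      using m0 by (intro sum_mono power_mono) (auto simp: m_def)
    also have "\<dots> \<le> e\<^sup>2 / 2" using N[of N "Suc k"] by simp
    finally have "(sqrt (real k) * m)\<^sup>2 \<le> e\<^sup>2" by (simp add: power_mult_distrib)
    then have "sqrt (real k) * m \<le> e" using e m0 by (simp add: abs_le_square_iff[symmetric])
    then show "norm (Min (a ` {..k})) \<le> e * norm (1 / sqrt (real k))"
      using m0 k by (simp add: m_def[symmetric] field_simps)
  qed
qed

section \<open>ADMM iterates\<close>

text \<open>\<open>F\<close> stands for the image function \<open>(Af)\<close>, characterized by \<open>F_le\<close> and \<open>F_approx\<close>; the infimum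
over a fibre of \<open>A\<close> need not be attained, hence the \<open>\<epsilon>\<close>.  The hypoconvexity modulus and the two parameter
regimes enter through the inequality \<open>gain\<close> alone.\<close>

locale admm_iterates =
  fixes f :: "real^'m \<Rightarrow> real" and g :: "real^'n \<Rightarrow> ereal"
    and A :: "real^'m^'p" and B :: "real^'n^'p" and b :: "real^'p"
    and \<beta> \<gamma> L lam c m :: real
    and F :: "real^'p \<Rightarrow> real" and G :: "real^'p \<Rightarrow> real^'p"
    and x_init :: "real^'m" and y_init :: "real^'p" and z_init :: "real^'n"
    and x :: "nat \<Rightarrow> real^'m" and y :: "nat \<Rightarrow> real^'p" and z :: "nat \<Rightarrow> real^'n"
  assumes f_lsc: "lsc (\<lambda>u. ereal (f u))" and g_proper: "proper g" and g_lsc: "lsc g"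
    and F_le: "\<And>u. F (A *v u) \<le> f u"
    and F_approx: "\<And>s \<epsilon>. 0 < \<epsilon> \<Longrightarrow> \<exists>u. A *v u = s \<and> f u < F s + \<epsilon>"
    and F_grad: "\<And>s. GDERIV F s :> G s" and G_lip: "lipschitz_on L UNIV G"
    and lower: "\<And>u w. A *v u + B *v w = b \<Longrightarrow> ereal m \<le> ereal (f u) + g w"
    and \<beta>_pos: "0 < \<beta>" and \<gamma>_def: "\<gamma> = 1 / \<beta>" and lam_pos: "0 < lam"
    and c_pos: "0 < c" and \<gamma>L: "\<gamma> * L < 1"
    and gain: "\<And>u v. \<gamma> / lam * (norm (G v - G u))\<^sup>2 - (F v - F u - inner (G u) (v - u))
      - (2 - lam) / (2 * lam * \<gamma>) * (norm (v - u))\<^sup>2 \<le> - c * (norm (v - u))\<^sup>2"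
    and step_init: "admm_step f g A B b \<beta> lam (x_init, y_init, z_init) (x 0, y 0, z 0)"
    and step: "\<And>k. admm_step f g A B b \<beta> lam (x k, y k, z k) (x (Suc k), y (Suc k), z (Suc k))"
begin

abbreviation res where "res k \<equiv> residual A B b (x k) (z k)"
abbreviation lag where "lag k \<equiv> aug_lagrangian f g A B b \<beta> (x k) (z k) (y k)"

definition gz where "gz k = real_of_ereal (g (z k))"
definition lagr where
  "lagr k = f (x k) + gz k + (inner (y k) (res k) + \<beta> / 2 * (norm (res k))\<^sup>2)"

lemma L_nonneg: "0 \<le> L"
  using lipschitz_on_nonneg[OF G_lip] .

lemma \<gamma>_pos: "0 < \<gamma>"
  using \<beta>_pos by (simp add: \<gamma>_def)

lemma L_less_\<beta>: "L < \<beta>"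
  using \<gamma>L \<beta>_pos by (simp add: \<gamma>_def field_simps)

text \<open>The iterate of index \<open>0\<close> is itself produced by a step, so that the optimality conditions of both
subproblems, and with them the finiteness of \<open>g\<close>, hold from index \<open>0\<close> on.\<close>

lemma z_in_argmin: "z k \<in> argmin_set (\<lambda>w. aug_lagrangian f g A B b \<beta> (x k) w (y k))"
proof (cases k)
  case 0 then show ?thesis using step_init by (auto simp only: admm_step_def Let_def case_prod_conv)
next
  case (Suc j) then show ?thesis using step[of j] by (auto simp only: admm_step_def Let_def case_prod_conv)
qed

lemma g_z: "g (z k) = ereal (gz k)"
  using z_update_finite[OF z_in_argmin g_proper, of k] by (simp add: gz_def ereal_real)

lemma lag_eq: "lag k = ereal (lagr k)"
  by (simp add: aug_lagrangian_def g_z lagr_def)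

lemma lag_le: "ereal (lagr k) \<le> aug_lagrangian f g A B b \<beta> (x k) w (y k)"
  using argmin_set_le[OF z_in_argmin, of k w] lag_eq[of k] by simp

lemma x_optimal:
  "f (x k) \<le> f u + inner (y k) (A *v (u - x k)) + \<beta> / 2 * (norm (A *v (u - x k)))\<^sup>2"
proof -
  have "\<exists>q w. x k \<in> argmin_set (\<lambda>u. aug_lagrangian f (\<lambda>_. 0) A B b \<beta> u w q)
      \<and> y k = q + \<beta> *\<^sub>R residual A B b (x k) w"
  proof (cases k)
    case 0 then show ?thesis using step_init by (auto simp: admm_step_def Let_def)
  next
    case (Suc j) then show ?thesis using step[of j] by (auto simp: admm_step_def Let_def)
  qed
  then show ?thesis using x_update_optimality by metis
qed

lemma f_x: "f (x k) = F (A *v x k)"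
proof (rule antisym)
  show "f (x k) \<le> F (A *v x k)"
  proof (rule field_le_epsilon)
    fix \<epsilon> :: real assume "0 < \<epsilon>"
    then obtain u where "A *v u = A *v x k" "f u < F (A *v x k) + \<epsilon>" using F_approx by blast
    then show "f (x k) \<le> F (A *v x k) + \<epsilon>"
      using x_optimal[of k u] by (simp add: matrix_vector_mult_diff_distrib)
  qed
qed (rule F_le)

text \<open>Because \<open>F\<close> is the image function, optimality of \<open>x k\<close> for \<open>f\<close> is optimality of \<open>A x k\<close> for \<open>F\<close>; hence the
multiplier is a function of \<open>A x k\<close>.\<close>

lemma G_Ax: "G (A *v x k) = - y k"
proof (rule GDERIV_eq_of_quadratic_minorant[OF F_grad])
  fix s
  show "F (A *v x k) \<le> F s + inner (y k) (s - A *v x k) + \<beta> / 2 * (norm (s - A *v x k))\<^sup>2"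
  proof (rule field_le_epsilon)
    fix \<epsilon> :: real assume "0 < \<epsilon>"
    then obtain u where "A *v u = s" "f u < F s + \<epsilon>" using F_approx by blast
    then show "F (A *v x k) \<le> F s + inner (y k) (s - A *v x k) + \<beta> / 2 * (norm (s - A *v x k))\<^sup>2 + \<epsilon>"
      using x_optimal[of k u] by (simp add: matrix_vector_mult_diff_distrib f_x)
  qed
qed

lemma multiplier_update: "y (Suc k) = y k - (\<beta> * (1 - lam)) *\<^sub>R res k + \<beta> *\<^sub>R residual A B b (x (Suc k)) (z k)"
  using step[of k] by (simp add: admm_step_def Let_def)

text \<open>The old \<open>z k\<close> competes with the new \<open>z\<close>.  In the notation of the proof \<open>p = v - u\<close>, and the cross terms
combine to \<open>\<langle>e - \<beta> d, p\<rangle>\<close>, which by \<open>\<lambda> p = d + \<gamma> e\<close> is a difference of squares.\<close>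

lemma sufficient_decrease:
  "lagr (Suc k) \<le> lagr k - c * lam\<^sup>2 / (1 + \<gamma> * L)\<^sup>2 * (norm (res k))\<^sup>2"
proof -
  define u where "u = A *v x k"
  define u' where "u' = A *v x (Suc k)"
  define d where "d = u' - u"
  define e where "e = G u' - G u"
  define p where "p = - res k"
  have r': "residual A B b (x (Suc k)) (z k) = d - p"
    by (simp add: residual_def d_def u_def u'_def p_def)
  have y: "y k = - G u" "y (Suc k) = - G u'" by (simp_all add: u_def u'_def G_Ax)
  have \<gamma>\<beta>: "\<gamma> * \<beta> = 1" using \<beta>_pos by (simp add: \<gamma>_def)
  have "- e = \<beta> *\<^sub>R (d - lam *\<^sub>R p)"
    using multiplier_update[of k] unfolding r' y
    by (simp add: e_def p_def algebra_simps)
  then have "- (\<gamma> *\<^sub>R e) = (\<gamma> * \<beta>) *\<^sub>R (d - lam *\<^sub>R p)" by (metis scaleR_minus_right scaleR_scaleR)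
  then have rel: "lam *\<^sub>R p = d + \<gamma> *\<^sub>R e" unfolding \<gamma>\<beta> by (simp add: algebra_simps)
  have "ereal (lagr (Suc k))
      \<le> ereal (F u' + gz k - inner (G u') (d - p) + \<beta> / 2 * (norm (d - p))\<^sup>2)"
    using lag_le[of "Suc k" "z k"]
    by (simp add: aug_lagrangian_def r' g_z f_x y u'_def[symmetric])
  then have 1: "lagr (Suc k) \<le> F u' + gz k - inner (G u') (d - p) + \<beta> / 2 * (norm (d - p))\<^sup>2"
    by simp
  have 2: "lagr k = F u + gz k + inner (G u) p + \<beta> / 2 * (norm p)\<^sup>2"
    by (simp add: lagr_def f_x y u_def p_def)
  have 3: "(norm (d - p))\<^sup>2 = (norm d)\<^sup>2 - 2 * inner d p + (norm p)\<^sup>2"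
    using norm_add_scaleR_sq[of d "-1" p] by simp
  have "lam * inner (e - \<beta> *\<^sub>R d) p = inner (e - \<beta> *\<^sub>R d) (d + \<gamma> *\<^sub>R e)"
    using rel by (metis inner_scaleR_right)
  also have "\<dots> = \<gamma> * (norm e)\<^sup>2 - \<beta> * (norm d)\<^sup>2 + (1 - \<gamma> * \<beta>) * inner d e"
    unfolding power2_norm_eq_inner by (simp add: inner_diff_left inner_add_right inner_commute algebra_simps)
  finally have 4: "inner (e - \<beta> *\<^sub>R d) p = (\<gamma> * (norm e)\<^sup>2 - \<beta> * (norm d)\<^sup>2) / lam"
    using lam_pos unfolding \<gamma>\<beta> by (simp add: field_simps)
  have "lagr (Suc k) - lagr k
      \<le> F u' - F u - inner (G u') d + inner (e - \<beta> *\<^sub>R d) p + \<beta> / 2 * (norm d)\<^sup>2"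
    using 1 unfolding 2 3
    by (simp add: e_def inner_diff_left inner_diff_right algebra_simps)
  also have "\<dots> = \<gamma> / lam * (norm (G u - G u'))\<^sup>2 - (F u - F u' - inner (G u') (u - u'))
      - (2 - lam) / (2 * lam * \<gamma>) * (norm (u - u'))\<^sup>2"
  proof -
    have n: "norm (G u - G u') = norm e" "norm (u - u') = norm d"
      by (simp_all add: e_def d_def norm_minus_commute)
    have i: "inner (G u') (u - u') = - inner (G u') d"
      by (simp add: d_def inner_diff_right)
    have \<gamma>: "(2 - lam) / (2 * lam * \<gamma>) = \<beta> / lam - \<beta> / 2"
      using lam_pos \<beta>_pos by (simp add: \<gamma>_def field_simps)
    show ?thesis unfolding 4 n i \<gamma> by (simp add: diff_divide_distrib left_diff_distrib)
  qed
  also have "\<dots> \<le> - c * (norm d)\<^sup>2"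
    using gain[of u u'] by (simp add: d_def norm_minus_commute)
  finally have 5: "lagr (Suc k) \<le> lagr k - c * (norm d)\<^sup>2" by simp
  have pos: "0 < 1 + \<gamma> * L" using \<gamma>_pos L_nonneg by (simp add: add_pos_nonneg)
  have "lam * norm p = norm (d + \<gamma> *\<^sub>R e)" using lam_pos by (metis abs_of_pos norm_scaleR rel)
  also have "\<dots> \<le> norm d + \<gamma> * norm e" using \<gamma>_pos norm_triangle_ineq[of d "\<gamma> *\<^sub>R e"] by simp
  also have "\<dots> \<le> norm d + \<gamma> * (L * norm d)"
    using lipschitz_onD[OF G_lip, of u' u] \<gamma>_pos by (simp add: dist_norm e_def d_def)
  also have "\<dots> = (1 + \<gamma> * L) * norm d" by (simp add: algebra_simps)
  finally have "(lam * norm p)\<^sup>2 \<le> ((1 + \<gamma> * L) * norm d)\<^sup>2"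
    using lam_pos by (intro power_mono) auto
  then have "lam\<^sup>2 / (1 + \<gamma> * L)\<^sup>2 * (norm p)\<^sup>2 \<le> (norm d)\<^sup>2"
    using pos by (simp add: power_mult_distrib divide_le_eq mult.commute)
  then have "c * (lam\<^sup>2 / (1 + \<gamma> * L)\<^sup>2 * (norm p)\<^sup>2) \<le> c * (norm d)\<^sup>2"
    using c_pos by (intro mult_left_mono) auto
  then show ?thesis using 5 by (simp add: p_def mult.assoc)
qed

text \<open>With \<open>y = - G u\<close> the smooth part of the Lagrangian is the quadratic model of \<open>F\<close> at \<open>u\<close> with
curvature \<open>\<beta> > L\<close>, evaluated at \<open>v\<close>, and therefore majorizes \<open>F v\<close>.\<close>

lemma lagr_ge_cost: "F (b - B *v z k) + gz k \<le> lagr k"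
proof -
  have eq: "b - B *v z k - A *v x k = - res k" by (simp add: residual_def algebra_simps)
  have "F (b - B *v z k) \<le> F (A *v x k) + inner (y k) (res k) + L / 2 * (norm (res k))\<^sup>2"
    using quadratic_upper_bound_of_lipschitz_gradient[OF F_grad G_lip, of "b - B *v z k" "A *v x k"]
    unfolding eq by (simp add: G_Ax)
  moreover have "L / 2 * (norm (res k))\<^sup>2 \<le> \<beta> / 2 * (norm (res k))\<^sup>2"
    using L_less_\<beta> by (intro mult_right_mono) auto
  ultimately show ?thesis by (simp add: lagr_def f_x)
qed

lemma lagr_lower_bound: "m \<le> lagr k"
proof -
  have "m \<le> F (b - B *v z k) + gz k"
  proof (rule field_le_epsilon)
    fix \<epsilon> :: real assume "0 < \<epsilon>"
    then obtain u where u: "A *v u = b - B *v z k" "f u < F (b - B *v z k) + \<epsilon>" using F_approx by blast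
    then show "m \<le> F (b - B *v z k) + gz k + \<epsilon>" using lower[of u "z k"] by (simp add: g_z)
  qed
  then show ?thesis using lagr_ge_cost[of k] by simp
qed

lemma decseq_lagr: "decseq lagr"
proof (rule decseq_SucI)
  fix k
  have "0 \<le> c * lam\<^sup>2 / (1 + \<gamma> * L)\<^sup>2 * (norm (res k))\<^sup>2" using c_pos by simp
  then show "lagr (Suc k) \<le> lagr k" using sufficient_decrease[of k] by linarith
qed

lemma convergent_lagr: "\<exists>l. lagr \<longlonglongrightarrow> l"
  using decseq_convergent[OF decseq_lagr, of m] lagr_lower_bound by metis

lemma summable_res_sq: "summable (\<lambda>k. (norm (res k))\<^sup>2)"
proof -
  define a where "a = c * lam\<^sup>2 / (1 + \<gamma> * L)\<^sup>2"
  have a: "0 < a" using c_pos lam_pos \<gamma>_pos L_nonneg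
    unfolding a_def by (intro divide_pos_pos mult_pos_pos zero_less_power add_pos_nonneg) auto
  have "(\<Sum>k<n. (norm (res k))\<^sup>2) \<le> (lagr 0 - m) / a" for n
  proof -
    have "a * (\<Sum>k<n. (norm (res k))\<^sup>2) \<le> (\<Sum>k<n. lagr k - lagr (Suc k))"
      unfolding sum_distrib_left using sufficient_decrease by (intro sum_mono) (simp add: a_def algebra_simps)
    also have "\<dots> = lagr 0 - lagr n" by (rule sum_lessThan_telescope')
    also have "\<dots> \<le> lagr 0 - m" using lagr_lower_bound by simp
    finally show ?thesis using a by (simp add: field_simps)
  qed
  then show ?thesis by (intro summableI_nonneg_bounded) auto
qed

lemma res_tendsto_0: "res \<longlonglongrightarrow> 0"
proof -
  have "(\<lambda>k. sqrt ((norm (res k))\<^sup>2)) \<longlonglongrightarrow> sqrt 0"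
    by (intro tendsto_real_sqrt summable_LIMSEQ_zero summable_res_sq)
  then show ?thesis by (simp add: tendsto_norm_zero_iff)
qed

lemma Min_res_smallo: "(\<lambda>k. Min ((\<lambda>i. norm (res i)) ` {..k})) \<in> o(\<lambda>k. 1 / sqrt (real k))"
  by (rule Min_smallo_of_summable_squares) (simp_all add: summable_res_sq)

lemma x_regular_subgradient: "- (transpose A *v y k) \<in> regular_subdiff (\<lambda>u. ereal (f u)) (x k)"
  by (rule regular_subgradient_of_quadratic_minorant[where \<beta> = \<beta>])
    (use \<beta>_pos x_optimal in \<open>auto simp: add.assoc\<close>)

lemma z_regular_subgradient: "- (transpose B *v (y k + \<beta> *\<^sub>R res k)) \<in> regular_subdiff g (z k)"
  by (rule regular_subgradient_of_quadratic_minorant[where \<beta> = \<beta>])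
    (use \<beta>_pos z_update_optimality[OF z_in_argmin] g_z in auto)

text \<open>Limiting subgradients require \<open>f (x k)\<close> and \<open>g (z k)\<close> to converge to the values at the cluster point.
For \<open>f\<close> this holds because \<open>f (x k) = F (A x k)\<close> and \<open>F\<close> is continuous; for \<open>g\<close>, the values converge since
the Lagrangian does, and their limit is identified by lower semicontinuity and minimality of \<open>z k\<close>.\<close>

lemma cluster_point_kkt:
  assumes l: "lagr \<longlonglongrightarrow> l" and cl: "cluster_point (\<lambda>k. (x k, z k, y k)) (xc, zc, yc)"
  shows "kkt_point f g A B b xc zc yc \<and> ereal (f xc) + g zc = ereal l"
proof -
  obtain r :: "nat \<Rightarrow> nat" where r: "strict_mono r"
    and "((\<lambda>k. (x k, z k, y k)) \<circ> r) \<longlonglongrightarrow> (xc, zc, yc)"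
    using cl by (auto simp: cluster_point_def)
  then have tri: "(\<lambda>k. (x (r k), z (r k), y (r k))) \<longlonglongrightarrow> (xc, zc, yc)" by (simp add: o_def)
  have X: "(\<lambda>k. x (r k)) \<longlonglongrightarrow> xc" and Z: "(\<lambda>k. z (r k)) \<longlonglongrightarrow> zc" and Y: "(\<lambda>k. y (r k)) \<longlonglongrightarrow> yc"
    using tendsto_fst[OF tri] tendsto_fst[OF tendsto_snd[OF tri]] tendsto_snd[OF tendsto_snd[OF tri]]
    by simp_all
  have AX: "(\<lambda>k. A *v x (r k)) \<longlonglongrightarrow> A *v xc" and BZ: "(\<lambda>k. B *v z (r k)) \<longlonglongrightarrow> B *v zc"
    by (intro bounded_linear.tendsto[OF matrix_vector_mul_bounded_linear] X Z)+
  have R0: "(\<lambda>k. res (r k)) \<longlonglongrightarrow> 0"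
    using LIMSEQ_subseq_LIMSEQ[OF res_tendsto_0 r] by (simp add: o_def)
  have Lr: "(\<lambda>k. lagr (r k)) \<longlonglongrightarrow> l" using LIMSEQ_subseq_LIMSEQ[OF l r] by (simp add: o_def)
  have "(\<lambda>k. res (r k)) \<longlonglongrightarrow> A *v xc + B *v zc - b"
    unfolding residual_def by (intro tendsto_intros AX BZ)
  then have feas: "A *v xc + B *v zc - b = 0" using R0 LIMSEQ_unique by blast
  have "isCont F (A *v xc)"
    using F_grad[of "A *v xc"] unfolding gderiv_def by (rule has_derivative_continuous)
  then have "(\<lambda>k. F (A *v x (r k))) \<longlonglongrightarrow> F (A *v xc)" using AX by (rule isCont_tendsto_compose)
  then have fl: "(\<lambda>k. f (x (r k))) \<longlonglongrightarrow> F (A *v xc)" by (simp add: f_x)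
  then have "ereal (f xc) \<le> ereal (F (A *v xc))"
    by (intro lsc_sequentially[OF f_lsc X]) auto
  then have fxc: "F (A *v xc) = f xc" using F_le[of xc] by simp
  note fl = fl[unfolded fxc]
  have pen: "(\<lambda>k. inner (y (r k)) (res (r k)) + \<beta> / 2 * (norm (res (r k)))\<^sup>2)
      \<longlonglongrightarrow> inner yc 0 + \<beta> / 2 * (norm (0::real^'p))\<^sup>2"
    by (intro tendsto_intros Y R0)
  have "(\<lambda>k. lagr (r k) - f (x (r k)) - (inner (y (r k)) (res (r k)) + \<beta> / 2 * (norm (res (r k)))\<^sup>2))
      \<longlonglongrightarrow> l - f xc - (inner yc 0 + \<beta> / 2 * (norm (0::real^'p))\<^sup>2)"
    by (intro tendsto_diff Lr fl pen)
  then have "(\<lambda>k. gz (r k)) \<longlonglongrightarrow> l - f xc" by (simp add: lagr_def)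
  then have gl: "(\<lambda>k. g (z (r k))) \<longlonglongrightarrow> ereal (l - f xc)" by (simp add: g_z)
  then have g_le: "g zc \<le> ereal (l - f xc)" by (intro lsc_sequentially[OF g_lsc Z])
  moreover have "g zc \<noteq> -\<infinity>" using g_proper by (simp add: proper_def)
  ultimately obtain t where t: "g zc = ereal t" by (cases "g zc") auto
  \<comment> \<open>comparing the minimizer \<open>z k\<close> with the cluster point gives the reverse inequality\<close>
  have "lagr (r k) \<le> f (x (r k)) + t + (inner (y (r k)) (residual A B b (x (r k)) zc)
      + \<beta> / 2 * (norm (residual A B b (x (r k)) zc))\<^sup>2)" for k
    using lag_le[of "r k" zc] by (simp add: aug_lagrangian_def t)
  moreover have "(\<lambda>k. f (x (r k)) + t + (inner (y (r k)) (residual A B b (x (r k)) zc)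
      + \<beta> / 2 * (norm (residual A B b (x (r k)) zc))\<^sup>2))
      \<longlonglongrightarrow> f xc + t + (inner yc (residual A B b xc zc) + \<beta> / 2 * (norm (residual A B b xc zc))\<^sup>2)"
    unfolding residual_def by (intro tendsto_intros fl Y AX)
  ultimately have "l \<le> f xc + t + (inner yc (residual A B b xc zc) + \<beta> / 2 * (norm (residual A B b xc zc))\<^sup>2)"
    by (intro LIMSEQ_le[OF Lr]) auto
  then have "l \<le> f xc + t" using feas by (simp add: residual_def)
  then have cost: "t = l - f xc" using g_le t by simp
  have "- (transpose A *v yc) \<in> limiting_subdiff (\<lambda>u. ereal (f u)) xc"
    unfolding limiting_subdiff_def
  proof (intro CollectI conjI exI)
    show "(\<lambda>k. x (r k)) \<longlonglongrightarrow> xc" by (rule X)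
    show "(\<lambda>k. ereal (f (x (r k)))) \<longlonglongrightarrow> ereal (f xc)" using fl by simp
    show "\<forall>k. - (transpose A *v y (r k)) \<in> regular_subdiff (\<lambda>u. ereal (f u)) (x (r k))"
      using x_regular_subgradient by blast
    show "(\<lambda>k. - (transpose A *v y (r k))) \<longlonglongrightarrow> - (transpose A *v yc)"
      by (intro tendsto_minus bounded_linear.tendsto[OF matrix_vector_mul_bounded_linear] Y)
  qed simp
  moreover have "- (transpose B *v yc) \<in> limiting_subdiff g zc"
    unfolding limiting_subdiff_def
  proof (intro CollectI conjI exI)
    show "(\<lambda>k. z (r k)) \<longlonglongrightarrow> zc" by (rule Z)
    show "(\<lambda>k. g (z (r k))) \<longlonglongrightarrow> g zc" using gl by (simp add: t cost)
    show "\<forall>k. - (transpose B *v (y (r k) + \<beta> *\<^sub>R res (r k))) \<in> regular_subdiff g (z (r k))"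
      using z_regular_subgradient by blast
    have "(\<lambda>k. y (r k) + \<beta> *\<^sub>R res (r k)) \<longlonglongrightarrow> yc + \<beta> *\<^sub>R 0"
      by (intro tendsto_intros Y R0)
    then show "(\<lambda>k. - (transpose B *v (y (r k) + \<beta> *\<^sub>R res (r k)))) \<longlonglongrightarrow> - (transpose B *v yc)"
      by (intro tendsto_minus bounded_linear.tendsto[OF matrix_vector_mul_bounded_linear]) simp
  qed (simp add: t)
  ultimately show ?thesis using feas t cost by (simp add: kkt_point_def)
qed

lemma bounded_res: "bounded (range res)"
  using res_tendsto_0 by (rule convergent_imp_bounded)

text \<open>A nearly optimal \<open>u\<close> in the fibre of \<open>A\<close> over \<open>b - B z k\<close> makes \<open>(u, z k)\<close> a feasible point
whose cost exceeds the Lagrangian by at most \<open>1\<close>.\<close>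

lemma bounded_z:
  assumes "level_bounded (Phi f g A B b)"
  shows "bounded (range z)"
proof -
  have "z k \<in> snd ` {p. Phi f g A B b p \<le> ereal (lagr 0 + 1)}" for k
  proof -
    obtain u where u: "A *v u = b - B *v z k" "f u < F (b - B *v z k) + 1"
      using F_approx[of 1] by auto
    moreover have "lagr k \<le> lagr 0" using decseq_lagr by (simp add: decseq_def)
    ultimately have "Phi f g A B b (u, z k) \<le> ereal (lagr 0 + 1)"
      using lagr_ge_cost[of k] by (simp add: Phi_def g_z)
    then show ?thesis by force
  qed
  then have "range z \<subseteq> snd ` {p. Phi f g A B b p \<le> ereal (lagr 0 + 1)}" by blast
  moreover have "bounded {p. Phi f g A B b p \<le> ereal (lagr 0 + 1)}"
    using assms by (simp add: level_bounded_def)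
  ultimately show ?thesis using bounded_snd bounded_subset by blast
qed

lemma bounded_Ax_y_Bz:
  assumes "level_bounded (Phi f g A B b)"
  shows "bounded (range (\<lambda>k. A *v x k))" "bounded (range y)" "bounded (range (\<lambda>k. B *v z k))"
proof -
  show Bz: "bounded (range (\<lambda>k. B *v z k))"
    using bounded_linear_image[OF bounded_z[OF assms] matrix_vector_mul_bounded_linear[of B]]
    by (simp add: image_image)
  have "A *v x k = res k + (b - B *v z k)" for k by (simp add: residual_def)
  moreover have "bounded (range (\<lambda>k. res k + (b - B *v z k)))"
    using bounded_res Bz by (intro bounded_plus_comp bounded_minus_comp) auto
  ultimately show Ax: "bounded (range (\<lambda>k. A *v x k))" by simp
  have "bounded (G ` range (\<lambda>k. A *v x k))"
    using Ax G_lip lipschitz_on_subset[OF G_lip, of "range (\<lambda>k. A *v x k)"]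
    by (intro bounded_uniformly_continuous_image lipschitz_on_uniformly_continuous) auto
  then have "bounded (range (\<lambda>k. - y k))" by (simp add: image_image G_Ax)
  then show "bounded (range y)" by (simp add: bounded_iff)
qed

text \<open>The correction \<open>d k\<close>, obtained from a right inverse of \<open>A\<close>, makes \<open>(x k - d k, z k)\<close> feasible.  Since the
gradient of \<open>f\<close> at \<open>x k\<close> is \<open>- A\<^sup>T y k\<close>, the first-order change in \<open>f\<close> is \<open>\<langle>y k, res k\<rangle>\<close>, which is bounded;
the remainder is bounded because the corrections tend to \<open>0\<close>.\<close>

lemma bounded_x:
  assumes lb: "level_bounded (Phi f g A B b)" and surj: "surj (\<lambda>u. A *v u)"
    and smooth: "smooth_with Lf f"
  shows "bounded (range x)"
proof -
  obtain h where h: "\<And>u. GDERIV f u :> h u" "lipschitz_on Lf UNIV h"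
    using smooth by (auto simp: smooth_with_def)
  obtain K where K: "\<And>v. norm (A *v v) \<le> norm v * K"
    using bounded_linear.pos_bounded[OF matrix_vector_mul_bounded_linear[of A]] by blast
  have hx: "h (x k) = - (transpose A *v y k)" for k
  proof (rule GDERIV_eq_of_quadratic_minorant[OF h(1)])
    fix u
    have "(norm (A *v (u - x k)))\<^sup>2 \<le> (norm (u - x k) * K)\<^sup>2" using K by (intro power_mono) auto
    then have "\<beta> / 2 * (norm (A *v (u - x k)))\<^sup>2 \<le> \<beta> / 2 * (norm (u - x k) * K)\<^sup>2"
      using \<beta>_pos by (intro mult_left_mono) auto
    then show "f (x k) \<le> f u + inner (transpose A *v y k) (u - x k) + \<beta> * K\<^sup>2 / 2 * (norm (u - x k))\<^sup>2"
      using x_optimal[of k u]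
      by (simp add: transpose_matrix_vector dot_lmul_matrix power_mult_distrib mult_ac)
  qed
  obtain R where R: "A ** R = mat 1"
    using surj matrix_right_invertible_surjective[of A] by blast
  define d where "d k = R *v res k" for k
  have d: "bounded (range d)"
    using bounded_linear_image[OF bounded_res matrix_vector_mul_bounded_linear[of R]]
    by (simp add: image_image d_def)
  have Ad: "A *v d k = res k" for k by (simp add: d_def matrix_vector_mul_assoc R)
  obtain Y D S where bd: "\<And>k. norm (y k) \<le> Y" "\<And>k. norm (d k) \<le> D" "\<And>k. norm (res k) \<le> S"
    using bounded_Ax_y_Bz(2)[OF lb] d bounded_res by (auto simp: bounded_iff)
  have nn: "0 \<le> Y" "0 \<le> D" "0 \<le> S" using bd norm_ge_zero order_trans by metis+
  have Lf: "0 \<le> Lf" using h(2) by (rule lipschitz_on_nonneg)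
  define C where "C = lagr 0 + Y * S + Y * S + Lf / 2 * D\<^sup>2"
  have "x k - d k \<in> fst ` {p. Phi f g A B b p \<le> ereal C}" for k
  proof -
    have feas: "A *v (x k - d k) + B *v z k = b"
      by (simp add: matrix_vector_mult_diff_distrib Ad) (simp add: residual_def)
    have ip: "\<bar>inner (y k) (res k)\<bar> \<le> Y * S"
      using Cauchy_Schwarz_ineq2[of "y k" "res k"] mult_mono[OF bd(1,3) nn(1) norm_ge_zero, of k k] by linarith
    have "f (x k - d k) \<le> f (x k) + inner (transpose A *v y k) (d k) + Lf / 2 * (norm (d k))\<^sup>2"
      using quadratic_upper_bound_of_lipschitz_gradient[OF h, of "x k - d k" "x k"] by (simp add: hx)
    also have "inner (transpose A *v y k) (d k) = inner (y k) (res k)"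
      by (simp add: transpose_matrix_vector dot_lmul_matrix Ad)
    also have "Lf / 2 * (norm (d k))\<^sup>2 \<le> Lf / 2 * D\<^sup>2"
      using bd(2) Lf by (intro mult_left_mono power_mono) auto
    finally have "f (x k - d k) + gz k \<le> f (x k) + gz k + Y * S + Lf / 2 * D\<^sup>2"
      using ip by simp
    moreover have "f (x k) + gz k \<le> lagr 0 + Y * S"
    proof -
      have "lagr k \<le> lagr 0" using decseq_lagr by (simp add: decseq_def)
      moreover have "0 \<le> \<beta> / 2 * (norm (res k))\<^sup>2" using \<beta>_pos by simp
      ultimately show ?thesis using ip unfolding lagr_def[of k] by linarith
    qed
    ultimately have "f (x k - d k) + gz k \<le> C" unfolding C_def by linarith
    then have "Phi f g A B b (x k - d k, z k) \<le> ereal C" using feas by (simp add: Phi_def g_z)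
    then show ?thesis by force
  qed
  then have "range (\<lambda>k. x k - d k) \<subseteq> fst ` {p. Phi f g A B b p \<le> ereal C}" by blast
  moreover have "bounded {p. Phi f g A B b p \<le> ereal C}"
    using lb by (simp add: level_bounded_def)
  ultimately have "bounded (range (\<lambda>k. x k - d k))" using bounded_fst bounded_subset by blast
  then have "bounded (range (\<lambda>k. (x k - d k) + d k))" using d by (intro bounded_plus_comp) auto
  then show ?thesis by simp
qed

end

section \<open>Convergence of ADMM\<close>

lemma image_fun_le: "image_fun C h (C *v u) \<le> h u"
  unfolding image_fun_def by (rule INF_lower) simp

lemma Phi_lower_bound:
  assumes arg: "argmin_set (Phi f g A B b) \<noteq> {}" and g: "proper g"
  obtains m where "\<And>u w. A *v u + B *v w = b \<Longrightarrow> ereal m \<le> ereal (f u) + g w"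
proof -
  obtain p where p: "p \<in> argmin_set (Phi f g A B b)" using arg by blast
  have "Phi f g A B b p \<noteq> -\<infinity>" using g by (cases p) (auto simp: Phi_def proper_def)
  then obtain m where m: "ereal m \<le> Phi f g A B b p" by (cases "Phi f g A B b p") auto
  show thesis
  proof (rule that)
    fix u w assume "A *v u + B *v w = b"
    then show "ereal m \<le> ereal (f u) + g w"
      using m argmin_set_le[OF p, of "(u, w)"] by (simp add: Phi_def)
  qed
qed

theorem theorem5p6:
  fixes f :: "real^'m \<Rightarrow> real" and g :: "real^'n \<Rightarrow> ereal"
    and A :: "real^'m^'p" and B :: "real^'n^'p" and b :: "real^'p"
    and \<beta> L \<sigma> p1 \<gamma> \<delta> lam c :: real
    and x_init :: "real^'m" and y_init :: "real^'p" and z_init :: "real^'n"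
    and x :: "nat \<Rightarrow> real^'m" and y :: "nat \<Rightarrow> real^'p" and z :: "nat \<Rightarrow> real^'n"
  assumes f: "proper (\<lambda>u. ereal (f u))" "lsc (\<lambda>u. ereal (f u))"
    and g: "proper g" "lsc g"
    and A_surj: "surj (\<lambda>u. A *v u)"
    and beta_pos: "\<beta> > 0"
    and sub_f: "\<And>s. argmin_set (\<lambda>u. f u + \<beta> / 2 * (norm (A *v u - s))\<^sup>2) \<noteq> {}"
    and sub_g: "\<And>s. argmin_set (\<lambda>w. g w + ereal (\<beta> / 2 * (norm (B *v w - s))\<^sup>2)) \<noteq> {}"
    and Af_finite: "\<And>s. \<bar>image_fun A (\<lambda>u. ereal (f u)) s\<bar> \<noteq> \<infinity>"
    and Af_smooth: "smooth_with L (\<lambda>s. real_of_ereal (image_fun A (\<lambda>u. ereal (f u)) s))"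
    and Af_hypo: "hypoconvex \<sigma> (\<lambda>s. real_of_ereal (image_fun A (\<lambda>u. ereal (f u)) s))"
    and Bg_lsc: "lsc (image_fun B g)"
    and Phi_argmin: "argmin_set (Phi f g A B b) \<noteq> {}"
    and L_pos: "L > 0" and sigma_range: "\<sigma> \<in> {-L..L}"
    and p1: "p1 = \<sigma> / L" and gamma: "\<gamma> = 1 / \<beta>"
    and delta: "\<delta> = sqrt ((p1 * lam)\<^sup>2 - 8 * p1 * (lam - 2))"
    and lam_pos: "lam > 0"
    and params:
      "(lam < 2 \<and>
        ereal \<gamma> < min (ereal (2 - lam) / ereal (2 * neg_part \<sigma>)) (ereal (1 / L)) \<and>
        c = (2 - lam) / (2 * lam * \<gamma>) -
            (if p1 \<ge> lam / 2 - 1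
             then L * max (neg_part p1 / (2 * (1 - neg_part p1))) (\<gamma> * L / lam - 1 / 2)
             else neg_part \<sigma> / lam))
       \<or>
       (\<sigma> > 0 \<and> 2 \<le> lam \<and> lam < 4 / (1 + sqrt (1 - p1)) \<and>
        (p1 * lam - \<delta>) / (4 * \<sigma>) < \<gamma> \<and> \<gamma> < (p1 * lam + \<delta>) / (4 * \<sigma>) \<and>
        c = (2 - lam) / (2 * lam * \<gamma>) + \<sigma> * (1 / 2 - \<gamma> * L / lam))"
    and step_init: "admm_step f g A B b \<beta> lam (x_init, y_init, z_init) (x 0, y 0, z 0)"
    and step: "\<And>k. admm_step f g A B b \<beta> lam (x k, y k, z k) (x (Suc k), y (Suc k), z (Suc k))"
  shows
    "((\<forall>k. aug_lagrangian f g A B b \<beta> (x (Suc k)) (z (Suc k)) (y (Suc k))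
           \<le> aug_lagrangian f g A B b \<beta> (x k) (z k) (y k)
             - ereal (c * lam\<^sup>2 / (1 + \<gamma> * L)\<^sup>2 * (norm (residual A B b (x k) (z k)))\<^sup>2))
      \<and> (\<lambda>k. residual A B b (x k) (z k)) \<longlonglongrightarrow> 0
      \<and> (\<lambda>k. Min ((\<lambda>i. norm (residual A B b (x i) (z i))) ` {..k})) \<in> o(\<lambda>k. 1 / sqrt (real k)))
     \<and>
     (\<exists>l::real. (\<lambda>k. aug_lagrangian f g A B b \<beta> (x k) (z k) (y k)) \<longlonglongrightarrow> ereal l
      \<and> (\<forall>xc zc yc. cluster_point (\<lambda>k. (x k, z k, y k)) (xc, zc, yc) \<longrightarrow>
            kkt_point f g A B b xc zc yc \<and> ereal (f xc) + g zc = ereal l))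
     \<and>
     (level_bounded (Phi f g A B b) \<longrightarrow>
        bounded (range (\<lambda>k. (A *v x k, y k, B *v z k)))
        \<and> ((\<exists>Lf. smooth_with Lf f) \<longrightarrow> bounded (range (\<lambda>k. (x k, y k, z k)))))"
proof -
  define F where "F s = real_of_ereal (image_fun A (\<lambda>u. ereal (f u)) s)" for s
  have F: "ereal (F s) = image_fun A (\<lambda>u. ereal (f u)) s" for s
    using Af_finite[of s] by (simp add: F_def ereal_real)
  obtain G where grad: "\<And>s. GDERIV F s :> G s" and lip: "lipschitz_on L UNIV G"
    using Af_smooth by (auto simp: smooth_with_def F_def[abs_def])
  have hypo: "hypoconvex \<sigma> F" using Af_hypo by (simp add: F_def[abs_def])
  have \<gamma>_pos: "0 < \<gamma>" using beta_pos gamma by simp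
  note gain = relaxation_gain[OF grad lip hypo L_pos sigma_range p1 \<gamma>_pos delta lam_pos params]
  obtain m where m: "\<And>u w. A *v u + B *v w = b \<Longrightarrow> ereal m \<le> ereal (f u) + g w"
    using Phi_lower_bound[OF Phi_argmin g(1)] by blast
  interpret admm_iterates f g A B b \<beta> \<gamma> L lam c m F G x_init y_init z_init x y z
  proof
    show "F (A *v u) \<le> f u" for u
      using image_fun_le[of A "\<lambda>u. ereal (f u)" u] by (simp add: F[symmetric])
    show "\<exists>u. A *v u = s \<and> f u < F s + \<epsilon>" if "0 < \<epsilon>" for s \<epsilon>
    proof -
      have "image_fun A (\<lambda>u. ereal (f u)) s < ereal (F s + \<epsilon>)"
        using that by (simp add: F[symmetric])
      then show ?thesis unfolding image_fun_def by (auto simp: INF_less_iff)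
    qed
  qed (fact f g grad lip m beta_pos gamma lam_pos gain step_init step)+
  obtain l where l: "lagr \<longlonglongrightarrow> l" using convergent_lagr by blast
  have decrease: "lag (Suc k) \<le> lag k - ereal (c * lam\<^sup>2 / (1 + \<gamma> * L)\<^sup>2 * (norm (res k))\<^sup>2)" for k
    using sufficient_decrease[of k] by (simp add: lag_eq)
  have lag_lim: "lag \<longlonglongrightarrow> ereal l" using l by (simp add: lag_eq)
  have bdd: "bounded (range (\<lambda>k. (A *v x k, y k, B *v z k)))"
    if "level_bounded (Phi f g A B b)"
    by (rule bounded_subset[OF bounded_Times[OF bounded_Ax_y_Bz(1)[OF that]
          bounded_Times[OF bounded_Ax_y_Bz(2,3)[OF that]]]]) auto
  have bdd_iterates: "bounded (range (\<lambda>k. (x k, y k, z k)))"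
    if "level_bounded (Phi f g A B b)" "smooth_with Lf f" for Lf
    by (rule bounded_subset[OF bounded_Times[OF bounded_x[OF that(1) A_surj that(2)]
          bounded_Times[OF bounded_Ax_y_Bz(2)[OF that(1)] bounded_z[OF that(1)]]]]) auto
  show ?thesis
    using decrease res_tendsto_0 Min_res_smallo lag_lim cluster_point_kkt[OF l] bdd bdd_iterates
    by blast
qed

end
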